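(* Let $\Gamma$ be a $4$-cycle, and let $\Delta$ be a finite $\Gamma$-partite graph with cycle connectors, no $3$-cycles and no $4$-cycles. Then $W_\Delta$ is $2$-dimensional, hyperbolic, and contains a finitely generated, non-finitely presentable (and in particular, non-quasiconvex) subgroup.
   Context: Right-angled Coxeter group (RACG): for a simplicial graph $\Delta$ with vertex set $V(\Delta)$ and edge set $E(\Delta)$, $W_\Delta=\langle s\in V(\Delta) \mid s^2=1 \text{ for all } s\in V(\Delta),\ st=ts \text{ for all } (s,t)\in E(\Delta)\rangle$; $V(\Delta)$ is its standard generating set. $W_\Delta$ is called $2$-dimensional if $\Delta$ contains no $3$-cycle. Quasiconvexity: a subgroup $H$ of a group $G$ with generating set $S$ is quasiconvex (with respect to $S$) if some finite-radius neighborhood of $H$ in the Cayley graph of $(G,S)$ contains every geodesic connecting a pair of vertices in $H$. Quasiconvexity in a RACG is with respect to the standard generating set. $\Gamma$-partite graphs: let $\Gamma$ have vertex set $\{s_1,\dots,s_n\}$. A simplicial graph $\Delta$ is $\Gamma$-partite if its vertex set can be partitioned into $n$ non-empty disjoint sets $A_1,\dots,A_n$ such that (1) no two vertices of $A_i$ are adjacent; (2) for all $1\le i<j\le n$, the subgraph $\Delta_{ij}$ of $\Delta$ induced by $A_i\cup A_j$ is connected if $s_i$ is adjacent to $s_j$ in $\Gamma$, and otherwise has no edges. $\Delta$ has cycle connectors if each $\Delta_{ij}$ is either edgeless or a (simple) cycle. *)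

theory Defs
  imports "HOL-Algebra.Generated_Groups" "Graph_Theory.Graph_Theory"
begin

section \<open>Groups given by generators and relators\<close>

text \<open>The letter \<open>(x, True)\<close> stands for the generator \<open>x\<close> and \<open>(x, False)\<close> for its
  formal inverse.\<close>

type_synonym 'x word = "('x \<times> bool) list"

definition words :: "'x set \<Rightarrow> 'x word set" where
  "words X = lists (X \<times> UNIV)"

inductive_set pres_rel :: "'x set \<Rightarrow> 'x word set \<Rightarrow> ('x word \<times> 'x word) set"
  for X :: "'x set" and R :: "'x word set" where
  refl: "u \<in> words X \<Longrightarrow> (u, u) \<in> pres_rel X R"
| sym: "(u, v) \<in> pres_rel X R \<Longrightarrow> (v, u) \<in> pres_rel X R"
| trans: "(u, v) \<in> pres_rel X R \<Longrightarrow> (v, w) \<in> pres_rel X R \<Longrightarrow> (u, w) \<in> pres_rel X R"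
| cancel: "u \<in> words X \<Longrightarrow> v \<in> words X \<Longrightarrow> x \<in> X
    \<Longrightarrow> (u @ [(x, b), (x, \<not> b)] @ v, u @ v) \<in> pres_rel X R"
| relator: "u \<in> words X \<Longrightarrow> v \<in> words X \<Longrightarrow> r \<in> R \<Longrightarrow> r \<in> words X
    \<Longrightarrow> (u @ r @ v, u @ v) \<in> pres_rel X R"

text \<open>The group \<open>\<langle>X | R\<rangle>\<close>: words modulo the congruence generated by free cancellation and by
  deleting relators.\<close>

definition presented_group :: "'x set \<Rightarrow> 'x word set \<Rightarrow> 'x word set monoid" where
  "presented_group X R =
    \<lparr>carrier = words X // pres_rel X R,
     monoid.mult = (\<lambda>A B. \<Union>u\<in>A. \<Union>v\<in>B. pres_rel X R `` {u @ v}),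
     monoid.one = pres_rel X R `` {[]}\<rparr>"

definition finitely_generated :: "('g, 'c) monoid_scheme \<Rightarrow> bool" where
  "finitely_generated G \<longleftrightarrow>
    (\<exists>S. finite S \<and> S \<subseteq> carrier G \<and> generate G S = carrier G)"

text \<open>Up to renaming, a finite generating alphabet is an initial segment of the natural numbers.\<close>

definition finitely_presentable :: "('g, 'c) monoid_scheme \<Rightarrow> bool" where
  "finitely_presentable G \<longleftrightarrow>
    (\<exists>(n::nat) R. finite R \<and> R \<subseteq> words {..<n} \<and> G \<cong> presented_group {..<n} R)"


section \<open>Geodesics, Cayley graphs, hyperbolicity, quasiconvexity\<close>

definition geodesic :: "('a, 'b) pre_digraph \<Rightarrow> 'a \<Rightarrow> 'b awalk \<Rightarrow> 'a \<Rightarrow> bool" where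
  "geodesic G u p v \<longleftrightarrow> pre_digraph.awalk G u p v \<and>
    (\<forall>q. pre_digraph.awalk G u q v \<longrightarrow> length p \<le> length q)"

text \<open>Vertices at combinatorial distance at most \<open>K\<close> from \<open>A\<close>.\<close>

definition nbhd :: "('a, 'b) pre_digraph \<Rightarrow> nat \<Rightarrow> 'a set \<Rightarrow> 'a set" where
  "nbhd G K A = {v. \<exists>a\<in>A. \<exists>q. pre_digraph.awalk G a q v \<and> length q \<le> K}"

text \<open>Rips' slim triangle condition. Triangles are geodesic edge paths with vertices as corners;
  passing to the geometric realization of the graph only changes the constant \<open>\<delta>\<close>. The same is
  true of the neighbourhoods in the definition of quasiconvexity.\<close>

definition slim_triangles :: "('a, 'b) pre_digraph \<Rightarrow> nat \<Rightarrow> bool" where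
  "slim_triangles G \<delta> \<longleftrightarrow>
    (\<forall>x y z p q r. geodesic G x p y \<and> geodesic G y q z \<and> geodesic G z r x \<longrightarrow>
      set (pre_digraph.awalk_verts G x p) \<subseteq>
        nbhd G \<delta> (set (pre_digraph.awalk_verts G y q) \<union> set (pre_digraph.awalk_verts G z r)))"

definition cayley_graph :: "('g, 'c) monoid_scheme \<Rightarrow> 'g set \<Rightarrow> 'g pair_pre_digraph" where
  "cayley_graph G S =
    \<lparr>pverts = carrier G,
     parcs = {(g, h). g \<in> carrier G \<and> h \<in> carrier G \<and>
       (\<exists>s\<in>S. h = g \<otimes>\<^bsub>G\<^esub> s \<or> g = h \<otimes>\<^bsub>G\<^esub> s)}\<rparr>"

definition hyperbolic_group :: "('g, 'c) monoid_scheme \<Rightarrow> bool" where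
  "hyperbolic_group G \<longleftrightarrow> group G \<and>
    (\<exists>S. finite S \<and> S \<subseteq> carrier G \<and> generate G S = carrier G \<and>
      (\<exists>\<delta>. slim_triangles (with_proj (cayley_graph G S)) \<delta>))"

definition quasiconvex :: "('g, 'c) monoid_scheme \<Rightarrow> 'g set \<Rightarrow> 'g set \<Rightarrow> bool" where
  "quasiconvex G S H \<longleftrightarrow>
    (\<exists>K. \<forall>h\<in>H. \<forall>h'\<in>H. \<forall>p. geodesic (with_proj (cayley_graph G S)) h p h' \<longrightarrow>
      set (pre_digraph.awalk_verts (with_proj (cayley_graph G S)) h p) \<subseteq>
        nbhd (with_proj (cayley_graph G S)) K H)"


section \<open>Cycles and partite graphs\<close>

text \<open>A simplicial graph is a loopfree symmetric digraph without parallel arcs: each edge is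
  represented by its two orientations. As the library counts \<open>a, b, a\<close> as a cycle of length 2,
  cycles are required to have length at least 3.\<close>

definition contains_cycle :: "('a, 'b) pre_digraph \<Rightarrow> nat \<Rightarrow> bool" where
  "contains_cycle G n \<longleftrightarrow> n \<ge> 3 \<and> (\<exists>p. pre_digraph.cycle G p \<and> length p = n)"

text \<open>The graph consists of the vertices and edges of one simple cycle of length \<open>n\<close>, and of
  nothing else.\<close>

definition cycle_graph :: "('a, 'b) pre_digraph \<Rightarrow> nat \<Rightarrow> bool" where
  "cycle_graph G n \<longleftrightarrow> n \<ge> 3 \<and>
    (\<exists>p. pre_digraph.cycle G p \<and> length p = n \<and> verts G = head G ` set p \<and>
      arcs_ends G = arc_to_ends G ` set p \<union> (arc_to_ends G ` set p)\<inverse>)"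

text \<open>The parts \<open>A s\<close> are indexed by the vertices \<open>s\<close> of \<open>\<Gamma>\<close>.\<close>

definition partite :: "'b pair_pre_digraph \<Rightarrow> 'a pair_pre_digraph \<Rightarrow> ('b \<Rightarrow> 'a set) \<Rightarrow> bool" where
  "partite \<Gamma> \<Delta> A \<longleftrightarrow>
    pverts \<Delta> = (\<Union>s\<in>pverts \<Gamma>. A s) \<and>
    (\<forall>s\<in>pverts \<Gamma>. A s \<noteq> {}) \<and>
    (\<forall>s\<in>pverts \<Gamma>. \<forall>t\<in>pverts \<Gamma>. s \<noteq> t \<longrightarrow> A s \<inter> A t = {}) \<and>
    (\<forall>s\<in>pverts \<Gamma>. \<forall>a\<in>A s. \<forall>b\<in>A s. (a, b) \<notin> parcs \<Delta>) \<and>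
    (\<forall>s\<in>pverts \<Gamma>. \<forall>t\<in>pverts \<Gamma>. s \<noteq> t \<longrightarrow>
      (if (s, t) \<in> parcs \<Gamma>
       then connected (with_proj \<Delta> \<restriction> (A s \<union> A t))
       else arcs (with_proj \<Delta> \<restriction> (A s \<union> A t)) = {}))"

definition cycle_connectors ::
  "'b pair_pre_digraph \<Rightarrow> 'a pair_pre_digraph \<Rightarrow> ('b \<Rightarrow> 'a set) \<Rightarrow> bool" where
  "cycle_connectors \<Gamma> \<Delta> A \<longleftrightarrow>
    (\<forall>s\<in>pverts \<Gamma>. \<forall>t\<in>pverts \<Gamma>. s \<noteq> t \<longrightarrow>
      arcs (with_proj \<Delta> \<restriction> (A s \<union> A t)) = {} \<or>
      (\<exists>n. cycle_graph (with_proj \<Delta> \<restriction> (A s \<union> A t)) n))"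


section \<open>Right-angled Coxeter groups\<close>

definition racg_relators :: "'a pair_pre_digraph \<Rightarrow> 'a word set" where
  "racg_relators \<Delta> =
    {[(s, True), (s, True)] | s. s \<in> pverts \<Delta>} \<union>
    {[(s, True), (t, True), (s, False), (t, False)] | s t. (s, t) \<in> parcs \<Delta>}"

definition racg :: "'a pair_pre_digraph \<Rightarrow> 'a word set monoid" where
  "racg \<Delta> = presented_group (pverts \<Delta>) (racg_relators \<Delta>)"

definition racg_gens :: "'a pair_pre_digraph \<Rightarrow> 'a word set set" where
  "racg_gens \<Delta> =
    (\<lambda>s. pres_rel (pverts \<Delta>) (racg_relators \<Delta>) `` {[(s, True)]}) ` pverts \<Delta>"

text \<open>By definition, 2-dimensionality of a right-angled Coxeter group is a property of its
  defining graph.\<close>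

definition racg_two_dimensional :: "'a pair_pre_digraph \<Rightarrow> bool" where
  "racg_two_dimensional \<Delta> \<longleftrightarrow> \<not> contains_cycle (with_proj \<Delta>) 3"

end

theory Submission
  imports Defs
begin

text \<open>
  Write \<open>W\<close> for the right-angled Coxeter group of \<open>\<Delta>\<close>. Its Cayley graph is the 1-skeleton of the
  Davis complex, a square complex in which every vertex has link \<open>\<Delta>\<close>; an edge path is a word in
  the vertices of \<open>\<Delta>\<close>, and homotopies are made of backtracks \<open>s s \<rightarrow> 1\<close> and of squares \<open>s t \<rightarrow> t s\<close>.
  All the geometry below takes place on such words.

  \<^emph>\<open>Hyperbolicity.\<close> Words can be put into normal form by cancelling two equal letters that are
  separated by letters commuting with them; this solves the word problem (\<open>reduced_imp_geodesic\<close>).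
  Two geodesics with the same ends differ by commutations, and if they drifted apart by more than
  one step, two letters of one would commute with two letters of the other, giving a cycle of
  length 3 or 4 in \<open>\<Delta>\<close>. So geodesic bigons are thin (\<open>bigon_thin\<close>), and since any two group
  elements have a longest common prefix through which a geodesic triangle can be rerouted
  (\<open>median\<close>), geodesic triangles are thin as well.

  \<^emph>\<open>The subgroup.\<close> Let \<open>A\<^sub>1, A\<^sub>2, A\<^sub>3, A\<^sub>4\<close> be the parts of \<open>\<Delta>\<close>, in the cyclic order of \<open>\<Gamma>\<close>.
  Collapsing each of them to a point maps \<open>W\<close> onto a product of two infinite dihedral groups,
  which acts on the square tiling of the plane: letters of \<open>A\<^sub>1\<close> and \<open>A\<^sub>3\<close> move horizontally,
  those of \<open>A\<^sub>2\<close> and \<open>A\<^sub>4\<close> vertically. The sum of the two coordinates is a height on the Davis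
  complex. At each vertex exactly one of the two horizontal parts and one of the two vertical
  parts descends, so the descending link is the subgraph of \<open>\<Delta>\<close> spanned by two adjacent parts, and
  likewise for the ascending link. The subgroup consists of the elements of \<open>W\<close> that translate the
  plane by \<open>(e, -e)\<close> with \<open>e\<close> even; it preserves the height.

  As in Bestvina--Brady Morse theory, connectedness of the links allows a path to be pushed off
  its highest or lowest vertices. So the strip of heights 0 and 1 is connected, and as the
  subgroup acts on it with finitely many orbits, the subgroup is finitely generated
  (\<open>short_gens_generate\<close>). If it were finitely presentable, all loops in the strip could be
  contracted below some fixed height \<open>U\<close>, because the subgroup preserves heights and finitely many
  relators suffice (\<open>finitely_presentable_imp_null_homotopies\<close>). But each descending link is a
  cycle. A loop running once around the descending link of a vertex \<open>v\<close> above height \<open>U\<close> can be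
  pushed down to the strip without meeting \<open>v\<close>, and it crosses a certain half of a wall at \<open>v\<close> an
  odd number of times. This parity only changes when a homotopy sweeps over a square at \<open>v\<close>, so
  the loop is essential below \<open>U\<close> (\<open>essential_strip_loop\<close>).

  Finally, a path that climbs \<open>n\<close> horizontal steps and then descends \<open>n\<close> vertical steps is
  geodesic already in the plane. For even \<open>n\<close> it joins two elements of the subgroup and reaches
  height \<open>n\<close>, so the subgroup is not quasiconvex.
\<close>

section \<open>Words up to cancellation and commutation\<close>

locale commutation_graph =
  fixes E :: "'a \<Rightarrow> 'a \<Rightarrow> bool"
  assumes E_sym: "E s t \<Longrightarrow> E t s" and E_irrefl: "\<not> E s s"
begin

inductive ceq :: "'a list \<Rightarrow> 'a list \<Rightarrow> bool" (infix \<open>\<approx>\<close> 50) where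
  ceq_refl: "u \<approx> u"
| ceq_sym: "u \<approx> v \<Longrightarrow> v \<approx> u"
| ceq_trans: "u \<approx> v \<Longrightarrow> v \<approx> w \<Longrightarrow> u \<approx> w"
| ceq_cancel: "u @ [s, s] @ v \<approx> u @ v"
| ceq_comm: "E s t \<Longrightarrow> u @ [s, t] @ v \<approx> u @ [t, s] @ v"

declare ceq_refl [simp, intro]
declare ceq_trans [trans]

lemma ceq_context: "u \<approx> v \<Longrightarrow> a @ u @ b \<approx> a @ v @ b"
proof (induction rule: ceq.induct)
  case (ceq_cancel u s v)
  then show ?case using ceq.ceq_cancel[of "a @ u" s "v @ b"] by simp
next
  case (ceq_comm s t u v)
  then show ?case using ceq.ceq_comm[of s t "a @ u" "v @ b"] by simp
qed (auto intro: ceq_sym ceq_trans)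

lemma ceq_append: "u \<approx> u' \<Longrightarrow> v \<approx> v' \<Longrightarrow> u @ v \<approx> u' @ v'"
  using ceq_context[of u u' "[]" v] ceq_context[of v v' u' "[]"] by (auto intro: ceq_trans)

lemma ceq_Cons: "u \<approx> v \<Longrightarrow> s # u \<approx> s # v"
  using ceq_append[of "[s]" "[s]" u v] by auto

lemma ceq_rev: "u \<approx> v \<Longrightarrow> rev u \<approx> rev v"
proof (induction rule: ceq.induct)
  case (ceq_cancel u s v)
  then show ?case using ceq.ceq_cancel[of "rev v" s "rev u"] by simp
next
  case (ceq_comm s t u v)
  then show ?case using ceq.ceq_comm[of t s "rev v" "rev u"] by (simp add: E_sym)
qed (auto intro: ceq_sym ceq_trans)

lemma rev_left_inverse: "rev u @ u \<approx> []"
proof (induction u)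
  case (Cons s u)
  have "rev u @ [s, s] @ u \<approx> rev u @ u" by (rule ceq_cancel)
  then show ?case using Cons by (auto intro: ceq_trans)
qed simp

lemma rev_right_inverse: "u @ rev u \<approx> []"
  using rev_left_inverse[of "rev u"] by simp

lemma ceq_cancel_left: "u @ v \<approx> u @ w \<longleftrightarrow> v \<approx> w"
proof
  assume "u @ v \<approx> u @ w"
  then have 1: "rev u @ u @ v \<approx> rev u @ u @ w" by (rule ceq_append[OF ceq_refl])
  have 2: "rev u @ u @ x \<approx> x" for x
    using ceq_append[OF rev_left_inverse[of u] ceq_refl[of x]] by simp
  show "v \<approx> w" by (meson 1 2 ceq_sym ceq_trans)
qed (simp add: ceq_append)

lemma ceq_move_left: "u @ v \<approx> w \<longleftrightarrow> v \<approx> rev u @ w"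
proof -
  have "u @ rev u @ w \<approx> w"
    using ceq_append[OF rev_right_inverse[of u] ceq_refl[of w]] by simp
  then show ?thesis
    by (metis ceq_cancel_left ceq_sym ceq_trans)
qed

lemma ceq_commute_word:
  "\<forall>r\<in>set u. E s r \<Longrightarrow> u @ [s] \<approx> s # u"
proof (induction u)
  case (Cons r u)
  have "r # u @ [s] \<approx> r # s # u" using Cons by (intro ceq_Cons) auto
  also have "r # s # u \<approx> s # r # u" using ceq_comm[of r s "[]" u] Cons by (auto intro: E_sym)
  finally show ?case by simp
qed simp

section \<open>Reduced words\<close>

text \<open>Equivalently, the first occurrence of \<open>s\<close> in the word can be brought to the front by commutations.\<close>
fun left_descent :: "'a \<Rightarrow> 'a list \<Rightarrow> bool" where
  "left_descent s [] \<longleftrightarrow> False"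
| "left_descent s (r # w) \<longleftrightarrow> r = s \<or> E s r \<and> left_descent s w"

fun reduced :: "'a list \<Rightarrow> bool" where
  "reduced [] \<longleftrightarrow> True"
| "reduced (s # w) \<longleftrightarrow> \<not> left_descent s w \<and> reduced w"

lemma left_descentD: "left_descent s w \<Longrightarrow> \<exists>x y. w = x @ s # y \<and> (\<forall>r\<in>set x. E s r) \<and> s \<notin> set x"
proof (induction w)
  case (Cons r w)
  show ?case
  proof (cases "r = s")
    case False
    with Cons obtain x y where "w = x @ s # y" "\<forall>r\<in>set x. E s r" "s \<notin> set x" by auto
    then show ?thesis using False Cons.prems by (intro exI[of _ "r # x"] exI[of _ y]) auto
  next
    case True
    then show ?thesis by (intro exI[of _ "[]"] exI[of _ w]) auto
  qed
qed simp

lemma left_descent_append: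
  "left_descent s (u @ v) \<longleftrightarrow> left_descent s u \<or> (\<forall>r\<in>set u. E s r) \<and> left_descent s v"
  by (induction u) auto

lemma left_descent_ceq: "left_descent s w \<Longrightarrow> w \<approx> s # remove1 s w"
proof -
  assume "left_descent s w"
  then obtain x y where w: "w = x @ s # y" "\<forall>r\<in>set x. E s r" "s \<notin> set x" using left_descentD
    by blast
  have "x @ [s] \<approx> s # x" using w by (simp add: ceq_commute_word)
  then have "(x @ [s]) @ y \<approx> (s # x) @ y" by (rule ceq_append) simp
  then show ?thesis using w by (simp add: remove1_append)
qed

lemma left_descent_set: "left_descent s w \<Longrightarrow> s \<in> set w"
  by (induction w) auto

text \<open>Bringing \<open>s\<close> to the front and deleting it creates no new cancellation: a letter that could cancel
  across the gap commutes with \<open>s\<close>, so it could have cancelled before.\<close>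
lemma reduced_remove1:
  "reduced w \<Longrightarrow> left_descent s w \<Longrightarrow> reduced (remove1 s w) \<and> \<not> left_descent s (remove1 s w)"
proof (induction w)
  case (Cons r w)
  show ?case
  proof (cases "r = s")
    case False
    then have s: "E s r" "left_descent s w" using Cons.prems by auto
    have "\<not> left_descent r (remove1 s w)"
    proof
      assume "left_descent r (remove1 s w)"
      moreover have "left_descent r (s # remove1 s w) \<longrightarrow> left_descent r w"
      proof -
        obtain x y where w: "w = x @ s # y" "\<forall>r\<in>set x. E s r" "s \<notin> set x"
          using left_descentD s by blast
        then have "remove1 s w = x @ y" by (simp add: remove1_append)
        then show ?thesis using w s E_sym False by (auto simp: left_descent_append)
      qed
      ultimately show False using Cons.prems s E_sym False by auto
    qed
    then show ?thesis using Cons s False by auto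
  qed (use Cons in auto)
qed simp

text \<open>A word up to commutations is determined by its projections to all pairs of letters that do not
  commute; pairs of commuting letters get an empty projection, so that equal families of
  projections mean equality up to commutation. The group acts on such families. This is van der
  Waerden's method of proving that a normal form is unique, with the advantage that commutation
  classes become functions.\<close>
definition pair_proj :: "'a list \<Rightarrow> 'a \<Rightarrow> 'a \<Rightarrow> 'a list" where
  "pair_proj w = (\<lambda>p q. if E p q then [] else filter (\<lambda>r. r = p \<or> r = q) w)"

definition leads :: "'a \<Rightarrow> ('a \<Rightarrow> 'a \<Rightarrow> 'a list) \<Rightarrow> bool" where
  "leads s \<phi> \<longleftrightarrow> (\<forall>p. \<not> E s p \<longrightarrow> \<phi> s p \<noteq> [] \<and> hd (\<phi> s p) = s)"

definition act :: "'a \<Rightarrow> ('a \<Rightarrow> 'a \<Rightarrow> 'a list) \<Rightarrow> 'a \<Rightarrow> 'a \<Rightarrow> 'a list" where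
  "act s \<phi> = (\<lambda>p q. if \<not> E p q \<and> (p = s \<or> q = s)
      then (if leads s \<phi> then tl (\<phi> p q) else s # \<phi> p q) else \<phi> p q)"

lemma leads_pair_proj: "leads s (pair_proj w) \<longleftrightarrow> left_descent s w"
proof (induction w)
  case Nil
  then show ?case using E_irrefl by (auto simp: leads_def pair_proj_def)
next
  case (Cons r w)
  consider "r = s" | "E s r" | "r \<noteq> s" "\<not> E s r" by blast
  then show ?case
  proof cases
    case 2
    then have "r \<noteq> s" using E_irrefl by auto
    have "pair_proj (r # w) s p = pair_proj w s p" if "\<not> E s p" for p
      using that 2 \<open>r \<noteq> s\<close> by (auto simp: pair_proj_def)
    then have "leads s (pair_proj (r # w)) \<longleftrightarrow> leads s (pair_proj w)" by (simp add: leads_def)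
    then show ?thesis using Cons 2 \<open>r \<noteq> s\<close> by simp
  next
    case 3
    then have "\<not> leads s (pair_proj (r # w))"
      by (auto simp: leads_def pair_proj_def intro!: exI[of _ r])
    then show ?thesis using 3 by simp
  qed (auto simp: leads_def pair_proj_def)
qed

definition lmult :: "'a \<Rightarrow> 'a list \<Rightarrow> 'a list" where
  "lmult s w = (if left_descent s w then remove1 s w else s # w)"

lemma reduced_lmult: "reduced w \<Longrightarrow> reduced (lmult s w)"
  using reduced_remove1 by (auto simp: lmult_def)

lemma pair_proj_lmult: "pair_proj (lmult s w) = act s (pair_proj w)"
proof (cases "left_descent s w")
  case True
  then obtain x y where w: "w = x @ s # y" "\<forall>r\<in>set x. E s r" "s \<notin> set x" using left_descentD
    by blast
  have 1: "filter (\<lambda>r. r = p \<or> r = q) x = []" if "\<not> E p q" "p = s \<or> q = s" for p q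
    using that w E_sym by (auto simp: filter_empty_conv)
  have 2: "lmult s w = x @ y" using w True by (simp add: lmult_def remove1_append)
  show ?thesis
    unfolding 2 act_def leads_pair_proj using True 1 w(1) by (auto simp: pair_proj_def fun_eq_iff)
next
  case False
  then have "leads s (pair_proj w) = False" by (simp add: leads_pair_proj)
  then show ?thesis using False
    by (simp add: lmult_def act_def) (auto simp: pair_proj_def fun_eq_iff)
qed

text \<open>On arbitrary families \<open>act s\<close> need not be an involution; on those of reduced words it is, because
  after deleting a leading \<open>s\<close> no other \<open>s\<close> can lead.\<close>
lemma act_involution:
  assumes "reduced w" shows "act s (act s (pair_proj w)) = pair_proj w"
proof -
  have "pair_proj (lmult s (lmult s w)) = pair_proj w"
  proof (cases "left_descent s w")
    case True
    then obtain x y where w: "w = x @ s # y" "\<forall>r\<in>set x. E s r" "s \<notin> set x" using left_descentD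
      by blast
    have 1: "filter (\<lambda>r. r = p \<or> r = q) x = []" if "\<not> E p q" "p = s \<or> q = s" for p q
      using that w E_sym by (auto simp: filter_empty_conv)
    have "lmult s (lmult s w) = s # x @ y"
      using reduced_remove1[OF assms True] w True by (auto simp: lmult_def remove1_append)
    then show ?thesis using 1 w(1) by (auto simp: pair_proj_def fun_eq_iff)
  qed (simp add: lmult_def)
  then show ?thesis by (simp add: pair_proj_lmult)
qed

text \<open>If \<open>s\<close> and \<open>t\<close> commute, no projection involves both, so they act on different components.\<close>
lemma act_commute:
  assumes "E s t" shows "act s (act t \<phi>) = act t (act s \<phi>)"
proof -
  have st: "s \<noteq> t" "E t s" using assms E_irrefl E_sym by auto
  have 1: "leads s (act t \<phi>) \<longleftrightarrow> leads s \<phi>"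
    using assms st unfolding leads_def act_def by (intro all_cong) auto
  have 2: "leads t (act s \<phi>) \<longleftrightarrow> leads t \<phi>"
    using assms st unfolding leads_def act_def by (intro all_cong) auto
  have 3: "act s (act t \<phi>) = (\<lambda>p q. if \<not> E p q \<and> (p = s \<or> q = s)
      then (if leads s \<phi> then tl (act t \<phi> p q) else s # act t \<phi> p q) else act t \<phi> p q)"
    unfolding act_def[of s "act t \<phi>"] 1 ..
  have 4: "act t (act s \<phi>) = (\<lambda>p q. if \<not> E p q \<and> (p = t \<or> q = t)
      then (if leads t \<phi> then tl (act s \<phi> p q) else t # act s \<phi> p q) else act s \<phi> p q)"
    unfolding act_def[of t "act s \<phi>"] 2 ..
  show ?thesis
    unfolding 3 4 unfolding act_def using assms st by (auto simp: fun_eq_iff)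
qed

fun normal_form :: "'a list \<Rightarrow> 'a list" where
  "normal_form [] = []"
| "normal_form (s # w) = lmult s (normal_form w)"

lemma reduced_normal_form: "reduced (normal_form w)"
  by (induction w) (auto intro: reduced_lmult)

lemma pair_proj_normal_form: "pair_proj (normal_form w) = foldr act w (pair_proj [])"
  by (induction w) (auto simp: pair_proj_lmult)

lemma normal_form_reduced: "reduced w \<Longrightarrow> normal_form w = w"
  by (induction w) (auto simp: lmult_def)

text \<open>The projections of the normal form are the result of letting the word act on the empty family, and
  the action respects both kinds of moves.\<close>
lemma ceq_imp_pair_proj_normal_form_eq:
  "u \<approx> v \<Longrightarrow> pair_proj (normal_form u) = pair_proj (normal_form v)"
proof (induction rule: ceq.induct)
  case (ceq_cancel u s v)
  have "act s (act s (pair_proj (normal_form v))) = pair_proj (normal_form v)"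
    by (rule act_involution[OF reduced_normal_form])
  then show ?case by (simp add: pair_proj_normal_form)
next
  case (ceq_comm s t u v)
  show ?case using act_commute[OF ceq_comm] by (simp add: pair_proj_normal_form)
qed auto

lemma reduced_ceq_imp_pair_proj_eq: "reduced u \<Longrightarrow> reduced v \<Longrightarrow> u \<approx> v \<Longrightarrow> pair_proj u = pair_proj v"
  using ceq_imp_pair_proj_normal_form_eq[of u v] by (simp add: normal_form_reduced)

lemma reduced_ceq_imp_left_descent_iff:
  "reduced u \<Longrightarrow> reduced v \<Longrightarrow> u \<approx> v \<Longrightarrow> left_descent s u \<longleftrightarrow> left_descent s v"
  using reduced_ceq_imp_pair_proj_eq[of u v] leads_pair_proj[of s u] leads_pair_proj[of s v] by simp

lemma pair_proj_eq_imp_length_eq: "pair_proj u = pair_proj v \<Longrightarrow> length u = length v"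
proof -
  assume "pair_proj u = pair_proj v"
  moreover have "pair_proj w p p = filter ((=) p) w" for w p
    by (auto simp: pair_proj_def E_irrefl intro!: filter_cong)
  ultimately have "filter ((=) p) u = filter ((=) p) v" for p by metis
  then have "count (mset u) p = count (mset v) p" for p
    by (simp add: count_mset count_list_eq_length_filter)
  then have "mset u = mset v" by (rule multiset_eqI)
  then show ?thesis by (rule mset_eq_length)
qed

lemma length_normal_form: "length (normal_form w) \<le> length w"
proof (induction w)
  case (Cons s w)
  then show ?case using left_descent_set[of s "normal_form w"]
    by (auto simp: lmult_def length_remove1)
qed simp

lemma reduced_imp_geodesic: "reduced w \<Longrightarrow> u \<approx> w \<Longrightarrow> length w \<le> length u"
  using ceq_imp_pair_proj_normal_form_eq[of u w] pair_proj_eq_imp_length_eq[of "normal_form u" "normal_form w"] 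
    length_normal_form[of u]
  by (simp add: normal_form_reduced)

lemma normal_form_ceq: "normal_form w \<approx> w"
proof (induction w)
  case (Cons s w)
  have "lmult s (normal_form w) \<approx> s # normal_form w"
  proof (cases "left_descent s (normal_form w)")
    case True
    have "s # normal_form w \<approx> s # s # remove1 s (normal_form w)" using left_descent_ceq[OF True]
      by (rule ceq_Cons)
    also have "s # s # remove1 s (normal_form w) \<approx> remove1 s (normal_form w)"
      using ceq_cancel[of "[]" s] by simp
    finally show ?thesis using True by (simp add: lmult_def ceq_sym)
  qed (simp add: lmult_def)
  also have "s # normal_form w \<approx> s # w" using Cons by (rule ceq_Cons)
  finally show ?case by simp
qed simp

lemma set_normal_form: "set (normal_form w) \<subseteq> set w"
proof (induction w)
  case (Cons s w)
  then show ?case using set_remove1_subset[of s "normal_form w"] by (auto simp: lmult_def)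
qed simp

lemma normal_form_shorter: "\<not> reduced w \<Longrightarrow> length (normal_form w) < length w"
proof (induction w)
  case (Cons s w)
  show ?case
  proof (cases "reduced w")
    case True
    then have "left_descent s w" using Cons by simp
    then show ?thesis using left_descent_set[of s w] True
      by (auto simp: lmult_def length_remove1 normal_form_reduced)
  next
    case False
    then show ?thesis using Cons left_descent_set[of s "normal_form w"]
      by (auto simp: lmult_def length_remove1)
  qed
qed simp

lemma reduced_if_geodesic: "(\<And>u. u \<approx> w \<Longrightarrow> set u \<subseteq> set w \<Longrightarrow> length w \<le> length u) \<Longrightarrow> reduced w"
  using normal_form_shorter[of w] normal_form_ceq[of w] set_normal_form[of w] by (meson not_less)

lemma reduced_same_length: "reduced u \<Longrightarrow> u \<approx> w \<Longrightarrow> length w \<le> length u \<Longrightarrow> reduced w"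
  by (rule reduced_if_geodesic) (meson ceq_sym ceq_trans le_trans reduced_imp_geodesic)

lemma reduced_rev: "reduced w \<Longrightarrow> reduced (rev w)"
proof (rule reduced_if_geodesic)
  fix u assume "reduced w" "u \<approx> rev w"
  then show "length (rev w) \<le> length u"
    using ceq_rev[of u "rev w"] reduced_imp_geodesic[of w "rev u"]
    by simp
qed

text \<open>In a right-angled Coxeter group, a cancellation in a product of two reduced words pairs a letter
  that can move to the end of the first with one that can move to the front of the second.\<close>
lemma reduced_append:
  "reduced a \<Longrightarrow> reduced v \<Longrightarrow> \<forall>c. \<not> (left_descent c (rev a) \<and> left_descent c v) \<Longrightarrow> reduced (a @ v)"
proof (induction a)
  case (Cons c a)
  have "reduced (a @ v)" using Cons by (auto simp: left_descent_append)
  moreover have "\<not> left_descent c (a @ v)" using Cons.prems by (auto simp: left_descent_append)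
  ultimately show ?case by simp
qed simp

text \<open>Stripping common left descents produces the longest common prefix \<open>m\<close> of the two words. Once there
  is no common descent left, \<open>reduced_append\<close> shows that the path from \<open>u\<close> to \<open>v\<close> through \<open>m\<close> is
  geodesic. So \<open>m\<close> is a median of \<open>1\<close>, \<open>u\<close> and \<open>v\<close>.\<close>
lemma median:
  "reduced u \<Longrightarrow> reduced v \<Longrightarrow> \<exists>m u' v'. u \<approx> m @ u' \<and> v \<approx> m @ v' \<and> reduced (m @ u') \<and> reduced (m @ v') \<and>
    reduced (rev u' @ v') \<and> set (m @ u' @ v') \<subseteq> set u \<union> set v"
proof (induction "length u" arbitrary: u v rule: less_induct)
  case less
  show ?case
  proof (cases "\<exists>s. left_descent s u \<and> left_descent s v")
    case True
    then obtain s where s: "left_descent s u" "left_descent s v" by blast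
    define u1 v1 where "u1 = remove1 s u" and "v1 = remove1 s v"
    have mem: "s \<in> set u" "s \<in> set v" using s left_descent_set by auto
    have ceq1: "u \<approx> s # u1" "v \<approx> s # v1" unfolding u1_def v1_def using s
      by (auto intro: left_descent_ceq)
    have rf1: "reduced u1" "reduced v1" unfolding u1_def v1_def using s less.prems reduced_remove1
      by auto
    have "length u1 < length u"
      using mem length_pos_if_in_set[OF mem(1)] by (auto simp: u1_def length_remove1)
    then obtain m u' v' where m: "u1 \<approx> m @ u'" "v1 \<approx> m @ v'" "reduced (m @ u')" "reduced (m @ v')"
      "reduced (rev u' @ v')" "set (m @ u' @ v') \<subseteq> set u1 \<union> set v1"
      using less.hyps[of u1 v1] rf1 by blast
    have c: "u \<approx> (s # m) @ u'" "v \<approx> (s # m) @ v'"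
      using ceq1 m(1,2)[THEN ceq_Cons[of _ _ s]] by (auto intro: ceq_trans)
    have l: "Suc (length u1) = length u" "Suc (length v1) = length v"
      using mem length_pos_if_in_set[OF mem(1)] length_pos_if_in_set[OF mem(2)]
      by (auto simp: u1_def v1_def length_remove1)
    have "length (m @ u') \<le> length u1" "length (m @ v') \<le> length v1"
      using m reduced_imp_geodesic by blast+
    then have "reduced ((s # m) @ u')" "reduced ((s # m) @ v')"
      using reduced_same_length[OF less.prems(1) c(1)] reduced_same_length[OF less.prems(2) c(2)] l
        by auto
    moreover have "set ((s # m) @ u' @ v') \<subseteq> set u \<union> set v"
      using m(6) mem set_remove1_subset[of s u] set_remove1_subset[of s v]
      unfolding u1_def v1_def by auto
    ultimately show ?thesis using c m(5) by blast
  next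
    case False
    then have "reduced (rev u @ v)" using less.prems by (intro reduced_append reduced_rev) auto
    then show ?thesis using less.prems by (intro exI[of _ "[]"] exI[of _ u] exI[of _ v]) auto
  qed
qed

end

section \<open>Geodesic bigons and triangles in girth at least five\<close>

locale girth_five_graph = commutation_graph E for E :: "'a \<Rightarrow> 'a \<Rightarrow> bool" +
  assumes no3: "\<And>a b c. E a b \<Longrightarrow> E b c \<Longrightarrow> E c a \<Longrightarrow> False"
    and no4: "\<And>a b c d. E a b \<Longrightarrow> E b c \<Longrightarrow> E c d \<Longrightarrow> E d a \<Longrightarrow> a \<noteq> c \<Longrightarrow> b \<noteq> d \<Longrightarrow> False"
begin

text \<open>After stripping common descents, every letter that can come first in \<open>u\<close> is a descent of \<open>v v'\<close>
  but not of \<open>v\<close>, so it commutes with all of \<open>v\<close>, and vice versa. If both prefixes still had two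
  letters, their first two letters would span a 4-cycle or a 3-cycle. So at most one letter is
  left on each side.\<close>
lemma bigon_thin:
  "reduced (u @ u') \<Longrightarrow> reduced (v @ v') \<Longrightarrow> u @ u' \<approx> v @ v' \<Longrightarrow> length u = length v
    \<Longrightarrow> \<exists>d. length d \<le> 2 \<and> set d \<subseteq> set u \<union> set v \<and> v \<approx> u @ d"
proof (induction "length u" arbitrary: u v rule: less_induct)
  case less
  show ?case
  proof (cases "\<exists>s. left_descent s u \<and> left_descent s v")
    case True
    then obtain s where s: "left_descent s u" "left_descent s v" by blast
    define u1 v1 where "u1 = remove1 s u" and "v1 = remove1 s v"
    have mem: "s \<in> set u" "s \<in> set v" using s left_descent_set by auto
    have ceq1: "u \<approx> s # u1" "v \<approx> s # v1" unfolding u1_def v1_def using s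
      by (auto intro: left_descent_ceq)
    have rm: "remove1 s (u @ u') = u1 @ u'" "remove1 s (v @ v') = v1 @ v'"
      using mem by (auto simp: u1_def v1_def remove1_append)
    have "reduced (u1 @ u')" "reduced (v1 @ v')"
      using reduced_remove1[of "u @ u'" s] reduced_remove1[of "v @ v'" s] less.prems s rm
      by (auto simp: left_descent_append)
    moreover have "u1 @ u' \<approx> v1 @ v'"
    proof -
      have "s # u1 @ u' \<approx> u @ u'" using ceq_append[OF ceq1(1) ceq_refl[of u']]
        by (simp add: ceq_sym)
      also note less.prems(3)
      also have "v @ v' \<approx> s # v1 @ v'" using ceq_append[OF ceq1(2) ceq_refl[of v']] by simp
      finally show ?thesis using ceq_cancel_left[of "[s]"] by simp
    qed
    moreover have "length u1 < length u" "length u1 = length v1"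
      using mem less.prems(4) length_pos_if_in_set[OF mem(1)]
      by (auto simp: u1_def v1_def length_remove1)
    ultimately obtain d where d: "length d \<le> 2" "set d \<subseteq> set u1 \<union> set v1" "v1 \<approx> u1 @ d"
      using less.hyps[of u1 v1] by blast
    have "v \<approx> s # u1 @ d" using ceq1(2) ceq_Cons[OF d(3)] by (blast intro: ceq_trans)
    also have "s # u1 @ d \<approx> u @ d" using ceq_append[OF ceq1(1) ceq_refl[of d]]
      by (simp add: ceq_sym)
    finally have "v \<approx> u @ d" .
    moreover have "set d \<subseteq> set u \<union> set v"
      using d(2) set_remove1_subset[of s u] set_remove1_subset[of s v] unfolding u1_def v1_def
        by blast
    ultimately show ?thesis using d(1) by blast
  next
    case False
    have cross: "\<forall>r\<in>set v. E c r" if "left_descent c u" for c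
      using that False reduced_ceq_imp_left_descent_iff[OF less.prems(1-3), of c]
        by (auto simp: left_descent_append)
    have cross': "\<forall>r\<in>set u. E c r" if "left_descent c v" for c
      using that False reduced_ceq_imp_left_descent_iff[OF less.prems(1-3), of c]
        by (auto simp: left_descent_append)
    consider "u = []" | s t where "u = [s]" "v = [t]"
      | s s2 u2 t t2 v2 where "u = s # s2 # u2" "v = t # t2 # v2"
      using less.prems(4) by (cases u; cases v; cases "tl u"; cases "tl v") auto
    then show ?thesis
    proof cases
      case 1
      then show ?thesis using less.prems(4) by auto
    next
      case (2 s t)
      have "[t] \<approx> [s] @ [s, t]" using ceq_cancel[of "[]" s "[t]"] by (simp add: ceq_sym)
      then show ?thesis using 2 by (intro exI[of _ "[s, t]"]) auto
    next
      case (3 s s2 u2 t t2 v2)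
      have Es: "\<forall>r\<in>set v. E s r" and Et: "\<forall>r\<in>set u. E t r"
        using cross[of s] cross'[of t] 3 by auto
      then have e: "E s t" "E s t2" "E t s2" using 3 by auto
      have ne: "s \<noteq> s2" "t \<noteq> t2" using less.prems(1,2) 3 by auto
      have nss: "\<not> E s s2" using no3[of s t s2] e E_sym by blast
      have sv: "s \<notin> set v" using Es E_irrefl by auto
      define v'' where "v'' = remove1 s v'"
      have cv: "left_descent s (v @ v')"
        using reduced_ceq_imp_left_descent_iff[OF less.prems(1-3), of s] 3 by simp
      have rm: "remove1 s (v @ v') = v @ v''" using sv by (simp add: v''_def remove1_append)
      have r1: "reduced (v @ v'')" using reduced_remove1[OF less.prems(2) cv] rm by simp
      have r2: "reduced (s2 # u2 @ u')" using less.prems(1) 3 by simp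
      have "s # s2 # u2 @ u' \<approx> s # v @ v''"
        using less.prems(3) left_descent_ceq[OF cv] 3 rm by (auto intro: ceq_trans)
      then have "s2 # u2 @ u' \<approx> v @ v''" using ceq_cancel_left[of "[s]"] by simp
      then have "left_descent s2 (v @ v'')" using reduced_ceq_imp_left_descent_iff[OF r2 r1, of s2]
        by simp
      moreover have "\<not> left_descent s2 v" using Es nss left_descent_set by blast
      ultimately have "E s2 t2" using 3 by (auto simp: left_descent_append)
      then show ?thesis using no4[of s t s2 t2] e ne E_sym by blast
    qed
  qed
qed

lemma bigon_take:
  assumes w: "reduced w" "reduced w'" "w \<approx> w'"
  shows "\<exists>d. length d \<le> 2 \<and> set d \<subseteq> set w \<union> set w' \<and> take i w' \<approx> take i w @ d"
proof -
  have "length w = length w'"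
    using reduced_imp_geodesic[of w w'] reduced_imp_geodesic[of w' w] w by (auto intro: ceq_sym)
  then obtain d where "length d \<le> 2" "set d \<subseteq> set (take i w) \<union> set (take i w')"
    "take i w' \<approx> take i w @ d"
    using bigon_thin[of "take i w" "drop i w" "take i w'" "drop i w'"] w by auto
  then show ?thesis using set_take_subset[of i w] set_take_subset[of i w'] by blast
qed

text \<open>The triangle with sides \<open>p\<close>, \<open>q\<close>, \<open>r\<close> is compared with the tripod of its median \<open>m\<close>. The two
  bigons used on the way from \<open>p\<close> to another side contribute 2 each to the constant 4.\<close>
lemma slim_words:
  assumes reduced: "reduced p" "reduced q" "reduced r" and closed: "p @ q @ r \<approx> []"
    and letters: "set p \<union> set q \<union> set r \<subseteq> V" and i: "i \<le> length p"
  shows "\<exists>d\<in>lists V. length d \<le> 4 \<and>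
    ((\<exists>j\<le>length q. take i p \<approx> p @ take j q @ d) \<or>
     (\<exists>j\<le>length r. take i p \<approx> p @ q @ take j r @ d))"
proof -
  obtain m u v where m: "p \<approx> m @ u" "rev r \<approx> m @ v" "reduced (m @ u)" "reduced (m @ v)" "reduced (rev u @ v)"
    "set (m @ u @ v) \<subseteq> set p \<union> set (rev r)"
    using median[OF reduced(1) reduced_rev[OF reduced(3)]] by blast
  have letters': "set (m @ u @ v) \<subseteq> V" using m(6) letters by auto
  have pq: "p @ q \<approx> rev r"
    using ceq_append[OF closed ceq_refl[of "rev r"]] rev_right_inverse[of r]
      ceq_append[OF ceq_refl[of "p @ q"] rev_right_inverse[of r]]
    by (auto intro: ceq_trans ceq_sym)
  have q: "rev u @ v \<approx> q"
  proof -
    have "(m @ u) @ q \<approx> m @ v"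
      using ceq_append[OF m(1) ceq_refl[of q]] pq m(2) by (meson ceq_sym ceq_trans)
    then have "u @ q \<approx> v" using ceq_cancel_left[of m] by simp
    then show ?thesis using ceq_move_left[of u q v] by (simp add: ceq_sym)
  qed
  obtain d1 where d1: "length d1 \<le> 2" "set d1 \<subseteq> set (m @ u) \<union> set p"
    "take i p \<approx> take i (m @ u) @ d1"
    using bigon_take[OF m(3) reduced(1), of i] m(1) by (auto intro: ceq_sym)
  show ?thesis
  proof (cases "i \<le> length m")
    case True
    obtain d2 where d2: "length d2 \<le> 2" "set d2 \<subseteq> set (rev r) \<union> set (m @ v)"
      "take i (m @ v) \<approx> take i (rev r) @ d2"
      using bigon_take[OF reduced_rev[OF reduced(3)] m(4), of i] m(2) by auto
    (* The side r runs back to the start of p, so prefixes of its reverse end at vertices of r. *)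
    define j where "j = length r - i"
    have "p @ q @ take j r \<approx> take i (rev r)"
    proof -
      have r: "rev r = take i (rev r) @ rev (take j r)"
        unfolding j_def by (metis append_take_drop_id drop_rev)
      have "p @ q @ take j r \<approx> (take i (rev r) @ rev (take j r)) @ take j r"
        using ceq_append[OF pq ceq_refl[of "take j r"]] r by simp
      also have "\<dots> \<approx> take i (rev r)"
        using ceq_append[OF ceq_refl[of "take i (rev r)"] rev_left_inverse[of "take j r"]] by simp
      finally show ?thesis .
    qed
    then have "p @ q @ take j r @ d2 @ d1 \<approx> take i (rev r) @ d2 @ d1"
      using ceq_append[of _ _ "d2 @ d1" "d2 @ d1"] by fastforce
    moreover have "take i p \<approx> take i (rev r) @ d2 @ d1"
      using d1(3) ceq_append[OF d2(3) ceq_refl[of d1]] True by (auto intro: ceq_trans)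
    ultimately have "take i p \<approx> p @ q @ take j r @ d2 @ d1" by (meson ceq_sym ceq_trans)
    moreover have "d2 @ d1 \<in> lists V" "j \<le> length r"
      using d1(2) d2(2) letters letters' by (auto simp: j_def)
    ultimately show ?thesis using d1(1) d2(1) by (intro bexI[of _ "d2 @ d1"]) auto
  next
    case False
    define k where "k = i - length m"
    define j where "j = length u - k"
    obtain d2 where d2: "length d2 \<le> 2" "set d2 \<subseteq> set q \<union> set (rev u @ v)"
      "take j (rev u @ v) \<approx> take j q @ d2"
      using bigon_take[OF reduced(2) m(5), of j] q by (auto intro: ceq_sym)
    have "length p = length (m @ u)"
      using reduced_imp_geodesic[of p "m @ u"] reduced_imp_geodesic[of "m @ u" p] reduced m(1,3)
      by (auto intro: ceq_sym)
    then have ku: "k \<le> length u" using i False by (simp add: k_def)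
    then have "rev (drop k u) = take j (rev u @ v)"
      by (simp add: j_def take_rev)
    moreover have "take k u \<approx> u @ rev (drop k u)"
      using ceq_append[OF ceq_refl[of "take k u"] rev_right_inverse[of "drop k u"]]
      by (simp add: ceq_sym flip: append_assoc)
    ultimately have "take k u \<approx> u @ take j q @ d2"
      using ceq_append[OF ceq_refl[of u] d2(3)] by (auto intro: ceq_trans)
    then have "m @ take k u @ d1 \<approx> (m @ u) @ take j q @ d2 @ d1"
      using ceq_context[of "take k u" "u @ take j q @ d2" m d1] by simp
    also have "\<dots> \<approx> p @ take j q @ d2 @ d1"
      using m(1) by (intro ceq_append ceq_sym[OF m(1)]) auto
    finally have "take i p \<approx> p @ take j q @ d2 @ d1"
      using d1(3) False by (auto simp: k_def intro: ceq_trans)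
    moreover have "j \<le> length q"
    proof -
      have "length (rev u @ v) \<le> length q" using reduced_imp_geodesic[OF m(5) ceq_sym[OF q]] .
      then show ?thesis by (simp add: j_def)
    qed
    moreover have "d2 @ d1 \<in> lists V"
      using d1(2) d2(2) letters letters' by auto
    ultimately show ?thesis using d1(1) d2(1) by (intro bexI[of _ "d2 @ d1"]) auto
  qed
qed

end

section \<open>A height function and its links\<close>

text \<open>The union of one horizontal and one vertical part. The parts of each direction are told apart by
  the Boolean \<open>par\<close>: at a vertex with an even coordinate the part with \<open>par\<close> false increases this
  coordinate and the other part decreases it, and at odd coordinates their roles are exchanged.\<close>
definition colour_link :: "'a set \<Rightarrow> ('a \<Rightarrow> bool) \<Rightarrow> ('a \<Rightarrow> bool) \<Rightarrow> bool \<Rightarrow> bool \<Rightarrow> 'a set" where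
  "colour_link V horizontal par p q = {s \<in> V. par s = (if horizontal s then p else q)}"

locale morse_graph = commutation_graph E for E :: "'a \<Rightarrow> 'a \<Rightarrow> bool" +
  fixes V :: "'a set" and horizontal par :: "'a \<Rightarrow> bool"
  assumes finite_V: "finite V"
    and E_horizontal: "E s t \<Longrightarrow> horizontal s \<noteq> horizontal t"
    and colour_nonempty: "\<exists>a\<in>V. horizontal a = d \<and> par a = p"
    and link_connected: "s \<in> colour_link V horizontal par p q \<Longrightarrow> r \<in> colour_link V horizontal par p q \<Longrightarrow>
      (s, r) \<in> {(a, b). a \<in> colour_link V horizontal par p q \<and> b \<in> colour_link V horizontal par p q \<and> E a b}\<^sup>*"
begin

text \<open>The infinite dihedral group acting simply transitively on the integers, in terms of the Cayley
  graph: from each integer, one generator leads to each of the two neighbours, alternatingly.\<close>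
definition zigzag :: "bool \<Rightarrow> int \<Rightarrow> int" where
  "zigzag p x = (if even x \<noteq> p then x + 1 else x - 1)"

fun coord :: "bool \<Rightarrow> int \<Rightarrow> 'a list \<Rightarrow> int" where
  "coord d x [] = x"
| "coord d x (s # w) = coord d (if horizontal s = d then zigzag (par s) x else x) w"

definition height :: "'a list \<Rightarrow> int" where
  "height g = coord True 0 g + coord False 0 g"

lemma zigzag_zigzag [simp]: "zigzag p (zigzag p x) = x"
  by (auto simp: zigzag_def)

lemma coord_append: "coord d x (u @ v) = coord d (coord d x u) v"
  by (induction u arbitrary: x) auto

lemma coord_ceq: "u \<approx> v \<Longrightarrow> coord d x u = coord d x v"
proof (induction arbitrary: x rule: ceq.induct)
  case (ceq_comm s t u v)
  then show ?case using E_horizontal[OF ceq_comm] by (auto simp: coord_append)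
qed (auto simp: coord_append)

lemma zigzag_shift: "even c \<Longrightarrow> zigzag p (c + x) = c + zigzag p x"
  by (auto simp: zigzag_def)

lemma coord_shift: "even c \<Longrightarrow> coord d (c + x) w = c + coord d x w"
  by (induction w arbitrary: x) (auto simp: zigzag_shift)

lemma height_ceq: "u \<approx> v \<Longrightarrow> height u = height v"
  by (simp add: height_def coord_ceq)

lemma coord_snoc:
  "coord d x (g @ [s]) = (if horizontal s = d then zigzag (par s) (coord d x g) else coord d x g)"
  by (simp add: coord_append)

lemma height_snoc:
  "height (g @ [s]) = height g + (if even (coord (horizontal s) 0 g) \<noteq> par s then 1 else - 1)"
  by (cases "horizontal s") (auto simp: height_def coord_snoc zigzag_def)

lemma height_Nil [simp]: "height [] = 0"
  by (simp add: height_def)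

text \<open>A path is given by a word \<open>g\<close> for its initial vertex and the word \<open>w\<close> of its edge labels.\<close>
fun confined :: "int \<Rightarrow> int \<Rightarrow> 'a list \<Rightarrow> 'a list \<Rightarrow> bool" where
  "confined L U g [] \<longleftrightarrow> L \<le> height g \<and> height g \<le> U"
| "confined L U g (s # w) \<longleftrightarrow> L \<le> height g \<and> height g \<le> U \<and> confined L U (g @ [s]) w"

lemma confined_start: "confined L U g w \<Longrightarrow> L \<le> height g \<and> height g \<le> U"
  by (cases w) auto

lemma confined_append: "confined L U g (a @ b) \<longleftrightarrow> confined L U g a \<and> confined L U (g @ a) b"
  by (induction a arbitrary: g) (auto dest: confined_start)

lemma confined_ceq: "g \<approx> g' \<Longrightarrow> confined L U g w \<longleftrightarrow> confined L U g' w"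
proof (induction w arbitrary: g g')
  case (Cons s w)
  have "g @ [s] \<approx> g' @ [s]" using Cons.prems by (simp add: ceq_append)
  then show ?case using Cons.IH height_ceq[OF Cons.prems] by simp
qed (simp add: height_ceq)

lemma confined_mono: "confined L U g w \<Longrightarrow> L' \<le> L \<Longrightarrow> U \<le> U' \<Longrightarrow> confined L' U' g w"
  by (induction w arbitrary: g) auto

text \<open>Homotopy of paths from the base vertex through squares whose four corners have height at most \<open>U\<close>.
  Backtracks may leave this part of the complex; this does no harm, as they sweep over no square.\<close>
inductive hom_below :: "int \<Rightarrow> 'a list \<Rightarrow> 'a list \<Rightarrow> bool" for U :: int where
  hom_below_refl: "hom_below U u u"
| hom_below_sym: "hom_below U u v \<Longrightarrow> hom_below U v u"
| hom_below_trans: "hom_below U u v \<Longrightarrow> hom_below U v w \<Longrightarrow> hom_below U u w"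
| hom_below_cancel: "hom_below U (u @ [s, s] @ v) (u @ v)"
| hom_below_comm: "E s t \<Longrightarrow> height u \<le> U \<Longrightarrow> height (u @ [s]) \<le> U \<Longrightarrow> height (u @ [t]) \<le> U \<Longrightarrow> height (u @ [s, t]) \<le> U
    \<Longrightarrow> hom_below U (u @ [s, t] @ v) (u @ [t, s] @ v)"

declare hom_below_refl [simp, intro]

lemma hom_below_imp_ceq: "hom_below U u v \<Longrightarrow> u \<approx> v"
proof (induction rule: hom_below.induct)
  case (hom_below_cancel u s v)
  show ?case by (rule ceq_cancel)
next
  case (hom_below_comm s t u v)
  then show ?case by (intro ceq_comm)
qed (auto intro: ceq_sym ceq_trans)

lemma hom_below_mono: "hom_below U u v \<Longrightarrow> U \<le> U' \<Longrightarrow> hom_below U' u v"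
proof (induction rule: hom_below.induct)
  case (hom_below_comm s t u v)
  then show ?case by (intro hom_below.hom_below_comm) auto
next
  case (hom_below_cancel u s v)
  show ?case by (rule hom_below.hom_below_cancel)
qed (auto intro: hom_below_sym hom_below_trans)

lemma ceq_imp_hom_below: "u \<approx> v \<Longrightarrow> \<exists>U. hom_below U u v"
proof (induction rule: ceq.induct)
  case (ceq_trans u v w)
  then obtain U U' where "hom_below U u v" "hom_below U' v w" by blast
  then have "hom_below (max U U') u w"
    by (meson hom_below_mono hom_below_trans max.cobounded1 max.cobounded2)
  then show ?case ..
next
  case (ceq_comm s t u v)
  show ?case
    by (rule exI[of _ "Max {height u, height (u @ [s]), height (u @ [t]), height (u @ [s, t])}"])
      (rule hom_below_comm[OF ceq_comm]; simp)
next
  case (ceq_cancel u s v)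
  show ?case using hom_below_cancel by blast
qed (auto intro: hom_below_sym)

lemma hom_below_append: "hom_below U u v \<Longrightarrow> hom_below U (u @ w) (v @ w)"
proof (induction rule: hom_below.induct)
  case (hom_below_cancel u s v)
  then show ?case using hom_below.hom_below_cancel[of U u s "v @ w"] by simp
next
  case (hom_below_comm s t u v)
  then show ?case using hom_below.hom_below_comm[of s t u U "v @ w"] by simp
qed (auto intro: hom_below.intros)

lemma hom_below_cancel_rev: "hom_below U (u @ a @ rev a @ v) (u @ v)"
proof (induction a arbitrary: u v)
  case (Cons s a)
  have "hom_below U ((u @ [s]) @ a @ rev a @ ([s] @ v)) ((u @ [s]) @ [s] @ v)" by (rule Cons)
  then show ?case using hom_below_cancel[of U u s v] by (auto intro: hom_below_trans)
qed simp

section \<open>Pushing paths towards a level\<close>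

abbreviation descending :: "'a list \<Rightarrow> 'a set" where
  "descending u \<equiv> colour_link V horizontal par (even (coord True 0 u)) (even (coord False 0 u))"

lemma descending_iff: "s \<in> descending u \<longleftrightarrow> s \<in> V \<and> height (u @ [s]) = height u - 1"
  by (cases "horizontal s") (auto simp: colour_link_def height_snoc)

lemma descending_iff_ascends: "s \<in> descending (p @ [s]) \<longleftrightarrow> s \<in> V \<and> height (p @ [s]) = height p + 1"
  using height_ceq[of "p @ [s, s]" p] ceq_cancel[of p s "[]"] descending_iff[of s "p @ [s]"] by auto

lemma descending_square:
  "s \<in> descending u \<Longrightarrow> t \<in> descending u \<Longrightarrow> E s t \<Longrightarrow> height (u @ [s, t]) = height u - 2"
  using height_snoc[of "u @ [s]" t] E_horizontal[of s t]
  by (cases "horizontal s") (auto simp: descending_iff coord_snoc height_snoc)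

text \<open>A path that passes through \<open>u = p s\<close> by the descending letters \<open>s\<close> and \<open>r\<close> can go around \<open>u\<close>: each
  edge of a path from \<open>s\<close> to \<open>r\<close> in the descending link of \<open>u\<close> is a square with top vertex \<open>u\<close>,
  and the path follows the two sides of this square that avoid \<open>u\<close>.\<close>
lemma link_sweep:
  assumes s: "s \<in> descending (p @ [s])"
    and sr: "(s, r) \<in> {(a, b). a \<in> descending (p @ [s]) \<and> b \<in> descending (p @ [s]) \<and> E a b}\<^sup>*"
  shows "\<exists>m\<in>lists V. hom_below (height p + 1) (p @ [s, r]) (p @ m) \<and> confined (height p - 1) (height p) p m"
  using sr
proof (induction rule: rtrancl_induct)
  case base
  then show ?case using hom_below_cancel[of "height p + 1" p s "[]"] by (intro bexI[of _ "[]"]) auto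
next
  case (step r r')
  define u where "u = p @ [s]"
  define U where "U = height p + 1"
  have r: "r \<in> descending u" "r' \<in> descending u" "E r r'" using step.hyps(2) by (auto simp: u_def)
  have hu: "height u = U" using s by (simp add: descending_iff_ascends u_def U_def)
  have rV: "r \<in> V" "r' \<in> V" using r by (auto simp: descending_iff)
  have h: "height (u @ [r]) = U - 1" "height (u @ [r']) = U - 1" "height (u @ [r, r']) = U - 2"
    using r hu descending_square[of r u r'] by (auto simp: descending_iff)
  obtain m where m: "m \<in> lists V" "hom_below U (u @ [r]) (p @ m)" "confined (U - 2) (U - 1) p m"
    using step.IH by (auto simp: u_def U_def)
  have "hom_below U (u @ [r', r, r]) (u @ [r'])"
    using hom_below_cancel[of U "u @ [r']" r "[]"] by simp
  moreover have "hom_below U (u @ [r, r', r]) (u @ [r', r, r])"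
    using hom_below_comm[of r r' u U "[r]"] h hu r(3) by simp
  moreover have "hom_below U (u @ [r, r', r]) (p @ m @ [r', r])"
    using hom_below_append[OF m(2), of "[r', r]"] by simp
  ultimately have "hom_below U (u @ [r']) (p @ m @ [r', r])"
    by (meson hom_below_trans hom_below_sym)
  moreover have "confined (U - 2) (U - 1) p (m @ [r', r])"
  proof -
    have c: "u @ [r] \<approx> p @ m" using m(2) by (rule hom_below_imp_ceq)
    have "u @ [r, r', r] \<approx> u @ [r', r, r]" using ceq_comm[of r r' u "[r]"] r by simp
    also have "u @ [r', r, r] \<approx> u @ [r']" using ceq_cancel[of "u @ [r']" r "[]"] by simp
    finally have "height (u @ [r, r', r]) = U - 1" using h height_ceq by metis
    then have "confined (U - 2) (U - 1) (u @ [r]) [r', r]" using h by simp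
    then show ?thesis using m(3) confined_ceq[OF c] by (simp only: confined_append)
  qed
  ultimately show ?case
    using m(1) rV by (intro bexI[of _ "m @ [r', r]"]) (auto simp: u_def U_def)
qed

lemma push_level:
  "w \<in> lists V \<Longrightarrow> confined L (k + 1) p w \<Longrightarrow> height p \<le> k \<Longrightarrow> height (p @ w) \<le> k \<Longrightarrow> L \<le> k - 1
    \<Longrightarrow> \<exists>w'\<in>lists V. hom_below (k + 1) (p @ w) (p @ w') \<and> confined L k p w'"
proof (induction "length w" arbitrary: w p rule: less_induct)
  case less
  consider "w = []" | s w1 where "w = s # w1" "height (p @ [s]) \<le> k"
    | s w1 where "w = s # w1" "height (p @ [s]) > k" by (cases w) force+
  then show ?case
  proof cases
    case 1
    then show ?thesis using less.prems by (intro bexI[of _ "[]"]) auto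
  next
    case (2 s w1)
    then obtain w' where "w' \<in> lists V" "hom_below (k + 1) ((p @ [s]) @ w1) ((p @ [s]) @ w')"
      "confined L k (p @ [s]) w'"
      using less.hyps[of w1 "p @ [s]"] less.prems by auto
    then show ?thesis using 2 less.prems by (intro bexI[of _ "s # w'"]) auto
  next
    case (3 s w1)
    then obtain r w2 where w1: "w1 = r # w2" using less.prems(4) by (cases w1) auto
    have hs: "height (p @ [s]) = k + 1" "height p = k"
      using 3 less.prems(2,3) height_snoc[of p s] confined_start[of L "k + 1" "p @ [s]" w1]
      by (auto split: if_splits)
    have V: "s \<in> V" "r \<in> V" "w2 \<in> lists V" using less.prems(1) 3 w1 by auto
    have "confined L (k + 1) (p @ [s, r]) w2" using less.prems(2) 3 w1 by simp
    then have hr: "height (p @ [s, r]) = k"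
      using confined_start height_snoc[of "p @ [s]" r] hs by (fastforce split: if_splits)
    have s: "s \<in> descending (p @ [s])" using V hs by (simp add: descending_iff_ascends)
    have r: "r \<in> descending (p @ [s])" using V hs hr by (simp add: descending_iff)
    obtain m where m: "m \<in> lists V" "hom_below (k + 1) (p @ [s, r]) (p @ m)" "confined (k - 1) k p m"
      using link_sweep[OF s link_connected[OF s r]] hs by auto
    have c: "p @ [s, r] \<approx> p @ m" using m(2) by (rule hom_below_imp_ceq)
    obtain w' where w': "w' \<in> lists V" "hom_below (k + 1) ((p @ [s, r]) @ w2) ((p @ [s, r]) @ w')"
      "confined L k (p @ [s, r]) w'"
      using less.hyps[of w2 "p @ [s, r]"] less.prems 3 w1 hr V by auto
    have "hom_below (k + 1) (p @ w) ((p @ [s, r]) @ w')" using w'(2) 3 w1 by simp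
    moreover have "hom_below (k + 1) ((p @ [s, r]) @ w') (p @ m @ w')"
      using hom_below_append[OF m(2), of w']
      by simp
    ultimately have "hom_below (k + 1) (p @ w) (p @ m @ w')" by (rule hom_below_trans)
    moreover have "confined L k p (m @ w')"
      using confined_mono[OF m(3), of L k] less.prems(5) w'(3) confined_ceq[OF c]
      by (simp add: confined_append)
    ultimately show ?thesis using m(1) w'(1) by (intro bexI[of _ "m @ w'"]) auto
  qed
qed

lemma push_down:
  "w \<in> lists V \<Longrightarrow> confined L U p w \<Longrightarrow> height p \<le> k \<Longrightarrow> height (p @ w) \<le> k \<Longrightarrow> L \<le> k - 1
    \<Longrightarrow> \<exists>w'\<in>lists V. hom_below U (p @ w) (p @ w') \<and> confined L k p w'"
proof (induction "nat (U - k)" arbitrary: U w)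
  case 0
  then show ?case using confined_mono[of L U p w L k] by auto
next
  case (Suc n)
  have k: "k \<le> U - 1" and n: "n = nat (U - 1 - k)" using Suc.hyps(2) by linarith+
  obtain w1 where w1: "w1 \<in> lists V" "hom_below U (p @ w) (p @ w1)" "confined L (U - 1) p w1"
    using push_level[of w L "U - 1" p] Suc.prems k by auto
  have "height (p @ w1) \<le> k" using height_ceq[OF hom_below_imp_ceq[OF w1(2)]] Suc.prems by simp
  then obtain w' where "w' \<in> lists V" "hom_below (U - 1) (p @ w1) (p @ w')" "confined L k p w'"
    using Suc.hyps(1)[OF n w1(1) w1(3)] Suc.prems by blast
  moreover from this(2) have "hom_below U (p @ w1) (p @ w')" by (rule hom_below_mono) simp
  ultimately show ?case using hom_below_trans[OF w1(2)] by blast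
qed

text \<open>Height zero makes the second coordinate the negative of the first one. Since translations of the
  plane are exactly the moves by an even amount in both directions, these words act by
  height-preserving translations.\<close>
definition level_word :: "'a list \<Rightarrow> bool" where
  "level_word w \<longleftrightarrow> height w = 0 \<and> even (coord True 0 w)"

lemma level_word_ceq: "u \<approx> v \<Longrightarrow> level_word u \<longleftrightarrow> level_word v"
  by (simp add: level_word_def height_ceq coord_ceq)

lemma level_word_coord_append:
  assumes "level_word h" shows "coord d 0 (h @ w) = coord d 0 h + coord d 0 w"
proof -
  have sum: "coord True 0 h + coord False 0 h = 0" and T: "even (coord True 0 h)"
    using assms by (simp_all add: level_word_def height_def)
  have "even (coord True 0 h + coord False 0 h)" unfolding sum by simp
  then have "even (coord d 0 h)" using T by (cases d) simp_all
  then show ?thesis using coord_shift[of "coord d 0 h" d 0 w] by (simp add: coord_append)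
qed

lemma height_level_word_append: "level_word h \<Longrightarrow> height (h @ w) = height w"
  by (simp add: height_def level_word_coord_append) (simp add: level_word_def height_def)

lemma level_word_append: "level_word h \<Longrightarrow> level_word (h @ w) \<longleftrightarrow> level_word w"
  using height_level_word_append[of h w] level_word_coord_append[of h True w]
    by (auto simp: level_word_def)

lemma level_word_Nil [simp]: "level_word []"
  by (simp add: level_word_def)

lemma level_word_rev: "level_word h \<Longrightarrow> level_word (rev h)"
  using level_word_append[of h "rev h"] level_word_ceq[OF rev_right_inverse[of h]] by simp

lemma hom_below_level_word_left: "level_word h \<Longrightarrow> hom_below U u v \<Longrightarrow> hom_below U (h @ u) (h @ v)"
proof -
  assume h: "level_word h" and "hom_below U u v"
  from this(2) show "hom_below U (h @ u) (h @ v)"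
  proof (induction rule: hom_below.induct)
    case (hom_below_cancel u s v)
    then show ?case using hom_below.hom_below_cancel[of U "h @ u" s v] by simp
  next
    case (hom_below_comm s t u v)
    then show ?case using hom_below.hom_below_comm[of s t "h @ u" U v] height_level_word_append[OF h]
      by simp
  qed (auto intro: hom_below.intros)
qed

lemma confined_exists: "\<exists>L U. confined L U g w"
proof (induction w arbitrary: g)
  case Nil
  show ?case by (intro exI[of _ "height g"]) simp
next
  case (Cons s w)
  then obtain L U where "confined L U (g @ [s]) w" by blast
  then have "confined (min L (height g)) (max U (height g)) (g @ [s]) w"
    by (rule confined_mono) auto
  then have "confined (min L (height g)) (max U (height g)) g (s # w)" by simp
  then show ?case by blast
qed

text \<open>Exchanging the two parts of each direction turns the plane upside down, which makes \<open>push_down\<close>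
  available for pushing upwards.\<close>
lemma morse_graph_flip: "morse_graph E V horizontal (\<lambda>s. \<not> par s)"
proof unfold_locales
  have link: "colour_link V horizontal (\<lambda>s. \<not> par s) p q = colour_link V horizontal par (\<not> p) (\<not> q)" for p q
    by (auto simp: colour_link_def)
  show "(s, r) \<in> {(a, b). a \<in> colour_link V horizontal (\<lambda>s. \<not> par s) p q \<and>
      b \<in> colour_link V horizontal (\<lambda>s. \<not> par s) p q \<and> E a b}\<^sup>*"
    if "s \<in> colour_link V horizontal (\<lambda>s. \<not> par s) p q" "r \<in> colour_link V horizontal (\<lambda>s. \<not> par s) p q"
    for s p q r
    using that unfolding link by (rule link_connected)
  show "\<exists>a\<in>V. horizontal a = d \<and> (\<not> par a) = p" for d p
    using colour_nonempty[of d "\<not> p"] by auto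
qed (use finite_V E_horizontal in auto)

lemma level_path:
  assumes w: "w \<in> lists V" "height w = 0"
  shows "\<exists>w'\<in>lists V. w' \<approx> w \<and> confined 0 1 [] w'"
proof -
  obtain L0 U where LU: "confined L0 U [] w" using confined_exists by blast
  define L where "L = min L0 0"
  have "confined L U [] w" by (rule confined_mono[OF LU]) (auto simp: L_def)
  moreover have "L \<le> 1 - 1" by (simp add: L_def)
  ultimately obtain w1 where w1: "w1 \<in> lists V" "hom_below U ([] @ w) ([] @ w1)" "confined L 1 [] w1"
    using push_down[of w L U "[]" 1] w by auto
  have c1: "w \<approx> w1" using hom_below_imp_ceq[OF w1(2)] by simp
  interpret flip: morse_graph E V horizontal "\<lambda>s. \<not> par s" by (rule morse_graph_flip)
  have coord: "flip.coord d (- x) u = - coord d x u" for d x u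
  proof (induction u arbitrary: x)
    case (Cons s u)
    have "flip.zigzag (\<not> p) (- x) = - zigzag p x" for p by (simp add: flip.zigzag_def zigzag_def)
    then show ?case using Cons by simp
  qed simp
  have height: "flip.height u = - height u" for u
    using coord[of True 0 u] coord[of False 0 u] by (simp add: height_def flip.height_def)
  have conf: "flip.confined a b g u \<longleftrightarrow> confined (- b) (- a) g u" for a b g u
    by (induction u arbitrary: g) (auto simp: height)
  have "flip.confined (- 1) (- L) [] w1" using w1(3) by (simp add: conf)
  then obtain w' where w': "w' \<in> lists V" "flip.hom_below (- L) ([] @ w1) ([] @ w')"
    "flip.confined (- 1) 0 [] w'"
    using flip.push_down[of w1 "- 1" "- L" "[]" 0] w1(1) w(2) height_ceq[OF c1] height by auto
  have "w1 \<approx> w'" using flip.hom_below_imp_ceq[OF w'(2)] by simp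
  then show ?thesis using w' c1 conf by (auto intro!: bexI[of _ w'] intro: ceq_trans ceq_sym)
qed

definition vert :: "bool \<Rightarrow> bool \<Rightarrow> 'a" where
  "vert d p = (SOME a. a \<in> V \<and> horizontal a = d \<and> par a = p)"

lemma vert: "vert d p \<in> V" "horizontal (vert d p) = d" "par (vert d p) = p"
  using someI_ex[of "\<lambda>a. a \<in> V \<and> horizontal a = d \<and> par a = p"] colour_nonempty[of d p]
  unfolding vert_def by blast+

text \<open>The level words act on the strip of heights 0 and 1 with finitely many orbits: at most two steps,
  which depend only on a parity and the height, lead from any vertex of the strip to a level word.\<close>
definition return_word :: "'a list \<Rightarrow> 'a list" where
  "return_word g =
    (if even (coord True 0 g) then (if height g = 0 then [] else [vert False False])
     else (if height g = 0 then [vert True False, vert False True] else [vert True False]))"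

lemma level_word_return_word:
  assumes "height g = 0 \<or> height g = 1" shows "level_word (g @ return_word g)"
proof -
  have "even (height g) \<longleftrightarrow> (even (coord True 0 g) \<longleftrightarrow> even (coord False 0 g))"
    by (simp add: height_def)
  then have "if height g = 0 then even (coord True 0 g) \<longleftrightarrow> even (coord False 0 g)
      else even (coord True 0 g) \<longleftrightarrow> odd (coord False 0 g)"
    using assms by auto
  then show ?thesis
    using assms by (auto simp: level_word_def return_word_def height_def coord_append vert zigzag_def split: if_splits)
qed

lemma return_word: "return_word g \<in> lists V" "length (return_word g) \<le> 2"
  by (auto simp: return_word_def vert)

text \<open>The bound is that for a return word backwards, an edge, and another return word: \<open>2 + 1 + 2\<close>.\<close>
definition short_gens :: "'a list set" where
  "short_gens = {w \<in> lists V. length w \<le> 5 \<and> level_word w}"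

lemma finite_short_gens: "finite short_gens"
proof -
  have "short_gens \<subseteq> {w. set w \<subseteq> V \<and> length w \<le> 5}" by (auto simp: short_gens_def)
  then show ?thesis using finite_lists_length_le[OF finite_V] finite_subset by blast
qed

text \<open>Every vertex of the path makes a detour to the subgroup and back. No square is used, so a loop in
  the strip becomes a product of short generators by a homotopy at any height.\<close>
lemma level_factor:
  "w \<in> lists V \<Longrightarrow> confined 0 1 p w \<Longrightarrow>
    \<exists>ts\<in>lists short_gens. hom_below U (p @ return_word p @ concat ts) (p @ w @ return_word (p @ w))"
proof (induction w arbitrary: p)
  case Nil
  then show ?case by (intro bexI[of _ "[]"]) auto
next
  case (Cons s w)
  define k k' where "k = return_word p" and "k' = return_word (p @ [s])"
  obtain ts where ts: "ts \<in> lists short_gens"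
    "hom_below U ((p @ [s]) @ k' @ concat ts) ((p @ [s]) @ w @ return_word ((p @ [s]) @ w))"
    using Cons.IH[of "p @ [s]"] Cons.prems unfolding k'_def by auto
  (* The edge s between the detours that end in the subgroup. *)
  define \<tau> where "\<tau> = rev k @ [s] @ k'"
  have "height p = 0 \<or> height p = 1" "height (p @ [s]) = 0 \<or> height (p @ [s]) = 1"
    using Cons.prems(2) confined_start[of 0 1 "p @ [s]" w] by auto
  then have H: "level_word (p @ k)" "level_word (p @ [s] @ k')"
    using level_word_return_word[of p] level_word_return_word[of "p @ [s]"]
      by (auto simp: k_def k'_def)
  have "(p @ k) @ \<tau> \<approx> p @ [s] @ k'"
    unfolding \<tau>_def using hom_below_imp_ceq[OF hom_below_cancel_rev[of 0 p k "[s] @ k'"]] by simp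
  then have "level_word ((p @ k) @ \<tau>)" using H(2) level_word_ceq by blast
  then have "level_word \<tau>" using level_word_append[OF H(1)] by blast
  moreover have "\<tau> \<in> lists V" "length \<tau> \<le> 5"
    using return_word[of p] return_word[of "p @ [s]"] Cons.prems(1)
    by (auto simp: \<tau>_def k_def k'_def in_lists_conv_set)
  ultimately have "\<tau> \<in> short_gens" by (simp add: short_gens_def)
  moreover have "hom_below U (p @ k @ concat (\<tau> # ts)) (p @ [s] @ k' @ concat ts)"
    unfolding \<tau>_def using hom_below_cancel_rev[of U p k "[s] @ k' @ concat ts"] by simp
  ultimately show ?case
    using ts unfolding k_def by (intro bexI[of _ "\<tau> # ts"]) (auto intro: hom_below_trans)
qed

lemma return_word_level_word: "level_word g \<Longrightarrow> return_word g = []"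
  by (simp add: return_word_def level_word_def)

lemma level_loop_factor:
  assumes "w \<in> lists V" "confined 0 1 [] w" "level_word w"
  shows "\<exists>ts\<in>lists short_gens. hom_below U (concat ts) w"
  using level_factor[OF assms(1,2), of U] assms(3) by (simp add: return_word_level_word)

lemma short_gens_generate:
  assumes "w \<in> lists V" "level_word w"
  shows "\<exists>ts\<in>lists short_gens. concat ts \<approx> w"
proof -
  obtain w' where w': "w' \<in> lists V" "w' \<approx> w" "confined 0 1 [] w'"
    using level_path[OF assms(1)] assms(2) by (auto simp: level_word_def)
  then have "level_word w'" using level_word_ceq assms(2) by blast
  then obtain ts where "ts \<in> lists short_gens" "hom_below 0 (concat ts) w'"
    using level_loop_factor[OF w'(1,3)] by blast
  then show ?thesis using w'(2) hom_below_imp_ceq by (blast intro: ceq_trans)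
qed

fun climb :: "nat \<Rightarrow> 'a list" where
  "climb 0 = []"
| "climb (Suc n) = climb n @ [vert True (odd n)]"

lemma climb: "climb n \<in> lists V" "coord True 0 (climb n) = int n" "coord False 0 (climb n) = 0"
  by (induction n) (auto simp: vert coord_append zigzag_def)

lemma height_climb: "height (climb n) = int n"
  by (simp add: height_def climb)

lemma confined_climb: "confined 0 (int n) [] (climb n)"
proof (induction n)
  case (Suc n)
  have "confined 0 (int (Suc n)) [] (climb n)" by (rule confined_mono[OF Suc]) auto
  then show ?case using height_climb[of n] height_climb[of "Suc n"] by (simp add: confined_append)
qed simp

fun sink :: "nat \<Rightarrow> 'a list" where
  "sink 0 = []"
| "sink (Suc n) = sink n @ [vert False (even n)]"

lemma sink: "sink n \<in> lists V" "length (sink n) = n"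
    "coord True x (sink n) = x" "coord False 0 (sink n) = - int n"
  by (induction n) (auto simp: vert coord_append zigzag_def)

lemma length_climb: "length (climb n) = n"
  by (induction n) auto

lemma displacement_le_length:
  "\<bar>coord True x w - x\<bar> + \<bar>coord False y w - y\<bar> \<le> int (length w)"
proof (induction w arbitrary: x y)
  case (Cons s w)
  show ?case
  proof (cases "horizontal s")
    case True
    then show ?thesis using Cons[of "zigzag (par s) x" y] by (auto simp: zigzag_def)
  next
    case False
    then show ?thesis using Cons[of x "zigzag (par s) y"] by (auto simp: zigzag_def)
  qed
qed simp

lemma height_le_length: "height w \<le> int (length w)"
  using displacement_le_length[of 0 w 0] by (simp add: height_def)

text \<open>The plane already forces this path to have minimal length.\<close>
lemma reduced_climb_sink: "reduced (climb n @ sink n)"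
proof (rule reduced_if_geodesic)
  fix u assume "u \<approx> climb n @ sink n"
  then have "coord d 0 u = coord d 0 (climb n @ sink n)" for d by (rule coord_ceq)
  then show "length (climb n @ sink n) \<le> length u"
    using displacement_le_length[of 0 u 0] by (simp add: coord_append climb sink length_climb)
qed

lemma level_word_climb_sink: "even n \<Longrightarrow> level_word (climb n @ sink n)"
  by (simp add: level_word_def height_def coord_append climb sink)

end

section \<open>Crossing parity with half a wall\<close>

text \<open>The edges labelled \<open>a\<close> that are parallel to the one at the base vertex form a wall; they start at
  the words in \<open>a\<close> and its neighbours. As no two neighbours of \<open>a\<close> commute, joining parallel edges
  across squares turns the wall into a tree. Removing the tree edge that crosses the square
  spanned by \<open>a\<close> and \<open>b\<close> leaves two halves. Counting crossings with the half on the side of \<open>b\<close>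
  gives a mod 2 cochain whose coboundary is that single square.\<close>
locale half_wall = morse_graph E V horizontal par for E :: "'a \<Rightarrow> 'a \<Rightarrow> bool" and V horizontal par +
  fixes a b :: 'a
  assumes ab: "E a b"
begin

lemma nbrs_not_adjacent: "E a r \<Longrightarrow> E a r' \<Longrightarrow> \<not> E r r'"
  using E_horizontal by blast

lemma a_neq_b [simp]: "a \<noteq> b" "b \<noteq> a"
  using ab E_irrefl by auto

text \<open>The retraction to the free product of the groups of order two generated by the neighbours of \<open>a\<close>.
  The free product acts on its normal forms, which are stored backwards, so the last element of
  the list is the first letter.\<close>
fun wall_pos :: "'a list \<Rightarrow> 'a list \<Rightarrow> 'a list" where
  "wall_pos l [] = l"
| "wall_pos l (r # w) =
    wall_pos (if E a r then (if l \<noteq> [] \<and> hd l = r then tl l else r # l) else l) w"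

lemma wall_pos_append: "wall_pos l (u @ v) = wall_pos (wall_pos l u) v"
  by (induction u arbitrary: l) auto

lemma distinct_adj_wall_pos: "distinct_adj l \<Longrightarrow> distinct_adj (wall_pos l w)"
proof (induction w arbitrary: l)
  case (Cons r w)
  have "distinct_adj (if E a r then (if l \<noteq> [] \<and> hd l = r then tl l else r # l) else l)"
    using Cons.prems by (cases l) (auto simp: distinct_adj_Cons)
  then show ?case unfolding wall_pos.simps by (rule Cons.IH)
qed simp

lemma wall_pos_twice: "distinct_adj l \<Longrightarrow> wall_pos l [r, r] = l"
  by (cases l) (auto simp: distinct_adj_Cons)

lemma wall_pos_ceq: "u \<approx> v \<Longrightarrow> distinct_adj l \<Longrightarrow> wall_pos l u = wall_pos l v"
proof (induction arbitrary: l rule: ceq.induct)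
  case (ceq_cancel u s v)
  then show ?case
    using wall_pos_twice[OF distinct_adj_wall_pos[of l u], of s] by (simp only: wall_pos_append)
next
  case (ceq_comm s t u v)
  then have "wall_pos l' [s, t] = wall_pos l' [t, s]" for l'
    using nbrs_not_adjacent[of s t] by auto
  then show ?case by (simp only: wall_pos_append)
qed auto

definition on_wall :: "'a list \<Rightarrow> bool" where
  "on_wall w \<longleftrightarrow> (\<exists>l. (\<forall>r\<in>set l. r = a \<or> E a r) \<and> w \<approx> l)"

definition beyond :: "'a list \<Rightarrow> bool" where
  "beyond w \<longleftrightarrow> on_wall w \<and> wall_pos [] w \<noteq> [] \<and> last (wall_pos [] w) = b"

lemma on_wall_ceq: "u \<approx> v \<Longrightarrow> on_wall u \<longleftrightarrow> on_wall v"
  unfolding on_wall_def by (meson ceq_sym ceq_trans)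

lemma beyond_ceq: "u \<approx> v \<Longrightarrow> beyond u \<longleftrightarrow> beyond v"
  using on_wall_ceq wall_pos_ceq[of u v "[]"] by (auto simp: beyond_def)

lemma on_wall_snoc:
  assumes r: "r = a \<or> E a r" shows "on_wall (w @ [r]) \<longleftrightarrow> on_wall w"
proof -
  have *: "on_wall (w @ [r])" if "on_wall w" for w
  proof -
    from that obtain l where l: "\<forall>r\<in>set l. r = a \<or> E a r" "w \<approx> l" by (auto simp: on_wall_def)
    then show ?thesis
      unfolding on_wall_def using r by (intro exI[of _ "l @ [r]"]) (auto intro: ceq_append)
  qed
  have "w @ [r] @ [r] \<approx> w" using ceq_cancel[of w r "[]"] by simp
  then show ?thesis using *[of w] *[of "w @ [r]"] on_wall_ceq by auto
qed

lemma set_wall_pos: "set (wall_pos l w) \<subseteq> set l \<union> {r. E a r}"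
proof (induction w arbitrary: l)
  case (Cons r w)
  have "set (if E a r then (if l \<noteq> [] \<and> hd l = r then tl l else r # l) else l) \<subseteq> set l \<union> {r. E a r}"
    by (cases l) auto
  then show ?case
    using Cons.IH[of "if E a r then (if l \<noteq> [] \<and> hd l = r then tl l else r # l) else l"] by auto
qed simp

text \<open>On the wall, the retraction loses nothing but the parity of the central letter \<open>a\<close>.\<close>
lemma on_wall_normal_form:
  assumes "on_wall w"
  shows "w \<approx> rev (wall_pos [] w) \<or> w \<approx> a # rev (wall_pos [] w)"
proof -
  from assms obtain l where l: "\<forall>r\<in>set l. r = a \<or> E a r" "w \<approx> l" by (auto simp: on_wall_def)
  have "l \<approx> rev (wall_pos [] l) \<or> l \<approx> a # rev (wall_pos [] l)" using l(1)
  proof (induction l rule: rev_induct)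
    case (snoc r l)
    define n where "n = wall_pos [] l"
    have IH: "l \<approx> rev n \<or> l \<approx> a # rev n" using snoc by (auto simp: n_def)
    have IHr: "l @ [r] \<approx> rev n @ [r] \<or> l @ [r] \<approx> a # rev n @ [r]"
      using IH ceq_append[of l _ "[r]" "[r]"] by fastforce
    show ?case
    proof (cases "r = a")
      case True
      have "rev n @ [a] \<approx> a # rev n"
        using set_wall_pos[of "[]" l] by (intro ceq_commute_word) (auto simp: n_def)
      moreover from this have "a # rev n @ [a] \<approx> rev n"
        using ceq_cancel[of "[]" a "rev n"] by (auto intro: ceq_trans ceq_Cons)
      moreover have "wall_pos [] (l @ [r]) = n"
        using True E_irrefl by (simp add: wall_pos_append n_def)
      ultimately show ?thesis using IHr True by (auto intro: ceq_trans)
    next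
      case False
      then have r: "E a r" using snoc.prems by auto
      have n': "wall_pos [] (l @ [r]) = (if n \<noteq> [] \<and> hd n = r then tl n else r # n)"
        using r by (simp add: wall_pos_append n_def)
      have "rev n @ [r] \<approx> rev (wall_pos [] (l @ [r]))"
        unfolding n' using ceq_cancel[of "rev (tl n)" r "[]"] by (cases n) auto
      then show ?thesis using IHr by (auto intro: ceq_trans ceq_Cons)
    qed
  qed simp
  moreover have "wall_pos [] l = wall_pos [] w"
    using wall_pos_ceq[OF l(2)] by simp
  ultimately show ?thesis using l(2) by (auto intro: ceq_trans)
qed

lemma beyond_snoc_a: "beyond (w @ [a]) \<longleftrightarrow> beyond w"
  using on_wall_snoc[of a w] E_irrefl by (simp add: beyond_def wall_pos_append)

text \<open>A step along the wall changes the first letter of the normal form only at the root of the tree,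
  and the half beyond \<open>b\<close> is left or entered only through the edge \<open>b\<close> there.\<close>
lemma beyond_snoc_nbr:
  assumes q: "E a q" and change: "beyond (w @ [q]) \<noteq> beyond w"
  shows "q = b \<and> (w \<approx> [] \<or> w \<approx> [a] \<or> w \<approx> [b] \<or> w \<approx> [a, b])"
proof -
  define n where "n = wall_pos [] w"
  have w: "on_wall w" using change on_wall_snoc[of q w] q by (auto simp: beyond_def)
  then have nf: "w \<approx> rev n \<or> w \<approx> a # rev n" unfolding n_def by (rule on_wall_normal_form)
  have n': "wall_pos [] (w @ [q]) = (if n \<noteq> [] \<and> hd n = q then tl n else q # n)"
    using q by (simp add: wall_pos_append n_def)
  have "(wall_pos [] (w @ [q]) \<noteq> [] \<and> last (wall_pos [] (w @ [q])) = b) \<noteq> (n \<noteq> [] \<and> last n = b)"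
    using change w on_wall_snoc[of q w] q by (auto simp: beyond_def n_def)
  then have "q = b \<and> (n = [] \<or> n = [b])"
    unfolding n' by (cases n; cases "tl n") (auto split: if_splits)
  then show ?thesis using nf by auto
qed

text \<open>This is the cochain described above, evaluated on the path \<open>w\<close> from \<open>g\<close>.\<close>
fun wind :: "'a list \<Rightarrow> 'a list \<Rightarrow> bool" where
  "wind g [] \<longleftrightarrow> False"
| "wind g (r # w) \<longleftrightarrow> (r = a \<and> beyond g) \<noteq> wind (g @ [r]) w"

lemma wind_append: "wind g (u @ v) \<longleftrightarrow> wind g u \<noteq> wind (g @ u) v"
  by (induction u arbitrary: g) auto

lemma wind_ceq: "g \<approx> g' \<Longrightarrow> wind g w \<longleftrightarrow> wind g' w"
proof (induction w arbitrary: g g')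
  case (Cons s w)
  have "g @ [s] \<approx> g' @ [s]" using Cons.prems by (simp add: ceq_append)
  then show ?case using Cons.IH beyond_ceq[OF Cons.prems] by simp
qed simp

lemma wind_backtrack: "wind g [s, s] \<longleftrightarrow> False"
  by (auto simp: beyond_snoc_a)

lemma wind_rev: "wind g (u @ rev u) \<longleftrightarrow> False"
proof (induction u arbitrary: g)
  case (Cons s u)
  have "g @ [s] @ u @ rev u \<approx> g @ [s]"
    using ceq_append[OF ceq_refl[of "g @ [s]"] rev_right_inverse[of u]] by simp
  then show ?case
    using Cons[of "g @ [s]"] wind_backtrack[of g s] wind_ceq[of "g @ [s] @ u @ rev u" "g @ [s]" "[s]"]
    by (simp add: wind_append[of _ "u @ rev u" "[s]", simplified])
qed simp

text \<open>The prefix \<open>rev v\<close> moves the half-wall so that it is rooted at \<open>v\<close>. The parity can only change at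
  the square spanned by \<open>a\<close> and \<open>b\<close> at \<open>v\<close>; since \<open>v\<close> is a corner of that square and lies above
  \<open>U\<close>, the square is not available.\<close>
lemma wind_hom_below:
  "hom_below U w w' \<Longrightarrow> U < height v \<Longrightarrow> wind (rev v) w \<longleftrightarrow> wind (rev v) w'"
proof (induction rule: hom_below.induct)
  case (hom_below_cancel u s w)
  have "(rev v @ u) @ [s, s] \<approx> rev v @ u" using ceq_cancel[of "rev v @ u" s "[]"] by simp
  then show ?case
    using wind_backtrack[of "rev v @ u" s] wind_ceq[of "(rev v @ u) @ [s, s]" "rev v @ u" w]
    by (simp only: wind_append append_assoc simp_thms)
next
  case (hom_below_comm s t u w)
  define g where "g = rev v @ u"
  (* The four cases are those in which v is a corner of the square at u. *)
  have far: False if "g \<approx> [] \<or> g \<approx> [s] \<or> g \<approx> [t] \<or> g \<approx> [s, t]"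
  proof -
    have "u @ e \<approx> v" if "g \<approx> rev e" for e
    proof -
      have "g @ e \<approx> []" using ceq_append[OF that ceq_refl[of e]] rev_left_inverse
        by (rule ceq_trans)
      then have "rev v @ u @ e \<approx> rev v @ v"
        using rev_left_inverse[of v] by (auto simp: g_def intro: ceq_trans ceq_sym)
      then show ?thesis using ceq_cancel_left by blast
    qed
    then have "height v = height (u @ e)" if "g \<approx> rev e" for e using that height_ceq by metis
    from this[of "[]"] this[of "[s]"] this[of "[t]"] this[of "[t, s]"]
    have "height v \<le> U"
      using that hom_below_comm height_ceq[OF ceq.ceq_comm[OF hom_below_comm(1), of u "[]"]] by auto
    then show False using \<open>U < height v\<close> by simp
  qed
  have ts: "E t s" using hom_below_comm(1) by (rule E_sym)
  have "wind g [s, t] \<longleftrightarrow> wind g [t, s]"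
  proof -
    consider "s = a" | "t = a" | "s \<noteq> a" "t \<noteq> a" by blast
    then show ?thesis
    proof cases
      case 1
      then have "t \<noteq> a" "E a t" using hom_below_comm(1) E_irrefl by auto
      then show ?thesis using 1 beyond_snoc_nbr[of t g] far by auto
    next
      case 2
      then have st: "s \<noteq> a" "E a s" using ts E_irrefl by auto
      have "[a, s] \<approx> [s, a]" using ceq.ceq_comm[OF st(2), of "[]" "[]"] by simp
      then show ?thesis using st 2 beyond_snoc_nbr[of s g] far by (auto intro: ceq_trans)
    qed auto
  qed
  moreover have "g @ [s, t] \<approx> g @ [t, s]" using ceq.ceq_comm[OF hom_below_comm(1), of g "[]"]
    by simp
  ultimately show ?case
    using wind_ceq[of "g @ [s, t]" "g @ [t, s]" w]
    by (simp only: wind_append append_assoc[symmetric] g_def)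
qed auto

abbreviation other_edges :: "'a list \<Rightarrow> ('a \<times> 'a) set" where
  "other_edges v \<equiv>
    {(r, r'). r \<in> descending v \<and> r' \<in> descending v \<and> E r r' \<and> (r, r') \<noteq> (a, b) \<and> (r, r') \<noteq> (b, a)}"

lemma wind_single:
  assumes "E a r" "r \<noteq> b" shows "\<not> beyond [r]" "\<not> beyond [a, r]"
  using assms E_irrefl by (auto simp: beyond_def)

lemma beyond_ab: "beyond [a, b]"
proof -
  have "on_wall [a, b]" unfolding on_wall_def using ab by (intro exI[of _ "[a, b]"]) auto
  then show ?thesis using ab E_irrefl by (simp add: beyond_def)
qed

text \<open>The first edge of the loop goes around the square of \<open>a\<close> and \<open>b\<close> at \<open>v\<close> and crosses the half-wall;
  the squares of the remaining link edges do not contribute.\<close>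
lemma link_loop:
  assumes v: "v = p @ [a]" and descending: "a \<in> descending v" "b \<in> descending v"
    and path: "(b, r) \<in> (other_edges v)\<^sup>*"
  shows "\<exists>m\<in>lists V. p @ m \<approx> v @ [r] \<and> confined (height p - 1) (height p) p m \<and> wind (rev v @ p) m"
  using path
proof (induction rule: rtrancl_induct)
  case base
  have hv: "height v = height p + 1" using descending(1) descending_iff_ascends v by simp
  have sq: "p @ [b, a] \<approx> v @ [b]" using ceq_comm[OF ab, of p "[]"] by (simp add: v ceq_sym)
  have hs: "height (p @ [b, a]) = height p" using height_ceq[OF sq] descending(2) hv
    by (simp add: descending_iff)
  have hb: "height (p @ [b]) = height p - 1"
  proof -
    have "v @ [a, b] \<approx> p @ [b]" using ceq_cancel[of p a "[b]"] by (simp add: v)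
    then show ?thesis using descending_square[OF descending ab] height_ceq hv by fastforce
  qed
  have "rev v @ p @ [b] \<approx> [a, b]"
    using ceq_append[OF rev_left_inverse[of p] ceq_refl[of "[b]"], THEN ceq_Cons[of _ _ a]]
    by (simp add: v)
  then have "beyond (rev v @ p @ [b])" using beyond_ab beyond_ceq by blast
  then have "wind (rev v @ p) [b, a]" by simp
  moreover have "[b, a] \<in> lists V" using descending by (auto simp: colour_link_def)
  moreover have "confined (height p - 1) (height p) p [b, a]" using hs hb by simp
  ultimately show ?case using sq by blast
next
  case (step r r')
  obtain m where m: "m \<in> lists V" "p @ m \<approx> v @ [r]" "confined (height p - 1) (height p) p m"
    "wind (rev v @ p) m" using step.IH by blast
  have r: "r \<in> descending v" "r' \<in> descending v" "E r r'" "(r, r') \<noteq> (a, b)" "(r, r') \<noteq> (b, a)"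
    using step.hyps(2) by auto
  have hv: "height v = height p + 1" using descending(1) descending_iff_ascends v by simp
  have c: "v @ [r, r', r] \<approx> v @ [r']"
  proof -
    have "v @ [r, r', r] \<approx> v @ [r', r, r]" using ceq_comm[OF r(3), of v "[r]"] by simp
    also have "v @ [r', r, r] \<approx> v @ [r']" using ceq_cancel[of "v @ [r']" r "[]"] by simp
    finally show ?thesis .
  qed
  have m': "p @ m @ [r', r] \<approx> v @ [r']"
    using ceq_append[OF m(2) ceq_refl[of "[r', r]"]] c by (auto intro: ceq_trans)
  have h: "height (v @ [r]) = height p" "height (v @ [r, r']) = height p - 1" "height (v @ [r, r', r]) = height p"
    using r descending_square[OF r(1-3)] hv height_ceq[OF c] by (auto simp: descending_iff)
  then have "confined (height p - 1) (height p) (v @ [r]) [r', r]" by simp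
  then have conf: "confined (height p - 1) (height p) p (m @ [r', r])"
    using m(3) confined_ceq[OF m(2)] by (simp only: confined_append)
  have "rev v @ p @ m \<approx> rev v @ v @ [r]" using m(2) by (simp add: ceq_append)
  also have "rev v @ v @ [r] \<approx> [r]"
    using ceq_append[OF rev_left_inverse[of v] ceq_refl[of "[r]"]] by simp
  finally have "wind (rev v @ p @ m) [r', r] \<longleftrightarrow> wind [r] [r', r]" by (rule wind_ceq)
  also have "\<dots> \<longleftrightarrow> False"
    using wind_single r E_sym E_irrefl by auto
  finally have "wind (rev v @ p) (m @ [r', r])" using m(4) by (simp add: wind_append)
  moreover have "m @ [r', r] \<in> lists V" using m(1) r by (auto simp: descending_iff)
  ultimately show ?case using m' conf by blast
qed

lemma confined_rev: "confined L U g w \<Longrightarrow> confined L U (g @ w) (rev w)"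
proof (induction w arbitrary: g)
  case (Cons s w)
  then have "confined L U (g @ [s] @ w) (rev w)" by fastforce
  moreover have "(g @ [s]) @ w @ rev w \<approx> g @ [s]"
    using ceq_append[OF ceq_refl[of "g @ [s]"] rev_right_inverse[of w]] by simp
  moreover have "confined L U (g @ [s]) [s]"
  proof -
    have "height (g @ [s, s]) = height g" using height_ceq[OF ceq_cancel[of g s "[]"]] by simp
    then show ?thesis using Cons.prems confined_start[of L U "g @ [s]" w] by simp
  qed
  ultimately show ?case using confined_ceq[of "(g @ [s]) @ w @ rev w" "g @ [s]" L U "[s]"]
    by (simp add: confined_append)
qed simp

text \<open>The loop goes around the descending link of the vertex \<open>v\<close> of height \<open>2 * n + 2 > U\<close>, based at the
  vertex \<open>p\<close> just below \<open>v\<close>. Pushing it down to the strip happens strictly below \<open>v\<close> and preserves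
  the crossing parity, which a contraction below \<open>U\<close> would preserve too.\<close>
lemma essential_strip_loop:
  assumes a: "a \<in> V" "horizontal a" "par a" and b: "b \<in> V" "\<not> horizontal b" "par b"
    and path: "(b, a) \<in> {(r, r'). r \<in> colour_link V horizontal par True True \<and>
      r' \<in> colour_link V horizontal par True True \<and> E r r' \<and> (r, r') \<noteq> (a, b) \<and> (r, r') \<noteq> (b, a)}\<^sup>*"
  shows "\<exists>w\<in>lists V. confined 0 1 [] w \<and> w \<approx> [] \<and> \<not> hom_below U w []"
proof -
  define n where "n = nat U"
  (* The odd length puts p just below v on the horizontal axis: there the even first coordinate of
     v makes a descend at v, and the second coordinate 0 makes b descend. *)
  define p where "p = climb (2 * n + 1)"
  define v where "v = p @ [a]"
  have p: "p \<in> lists V" "height p = 2 * int n + 1" "confined 0 (2 * int n + 1) [] p"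
    using climb(1) height_climb[of "2 * n + 1"] confined_climb[of "2 * n + 1"]
    by (simp_all add: p_def add.commute del: climb.simps)
  have coord: "coord True 0 v = 2 * int n + 2" "coord False 0 v = 0"
    using climb(2,3)[of "2 * n + 1"] a
      by (auto simp: v_def coord_append p_def zigzag_def simp del: climb.simps)
  have d: "descending v = colour_link V horizontal par True True" unfolding coord by simp
  have descending: "a \<in> descending v" "b \<in> descending v" unfolding d using a b
    by (auto simp: colour_link_def)
  have hv: "height v = 2 * int n + 2" by (simp add: height_def coord)
  obtain m where m: "m \<in> lists V" "p @ m \<approx> v @ [a]" "confined (height p - 1) (height p) p m"
    "wind (rev v @ p) m"
    using link_loop[OF v_def descending, of a] path unfolding d by blast
  define l where "l = p @ m @ rev p"
  have pm: "p @ m \<approx> p" using m(2) ceq_cancel[of p a "[]"] by (auto simp: v_def intro: ceq_trans)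
  have lV: "l \<in> lists V" using p(1) m(1) by (auto simp: l_def)
  have l1: "l \<approx> []"
    using ceq_append[OF pm ceq_refl[of "rev p"]] rev_right_inverse[of p]
    by (auto simp: l_def intro: ceq_trans)
  have "confined 0 (2 * int n + 1) p m" by (rule confined_mono[OF m(3)]) (auto simp: p)
  moreover have "confined 0 (2 * int n + 1) (p @ m) (rev p)"
    using confined_rev[OF p(3)] confined_ceq[OF pm] by simp
  ultimately have conf: "confined 0 (2 * int n + 1) [] l"
    using p(3) by (simp add: l_def confined_append)
  have "wind (rev v @ p @ m) (rev p) \<longleftrightarrow> wind (rev v @ p) (rev p)"
    using pm by (intro wind_ceq) (simp add: ceq_append)
  moreover have "wind (rev v) p \<longleftrightarrow> wind (rev v @ p) (rev p)"
    using wind_rev[of "rev v" p] by (simp add: wind_append)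
  ultimately have wl: "wind (rev v) l" using m(4) by (auto simp: l_def wind_append)
  obtain w where w: "w \<in> lists V" "hom_below (2 * int n + 1) ([] @ l) ([] @ w)" "confined 0 1 [] w"
    using push_down[OF lV conf, of 1] height_ceq[OF l1] by auto
  have "wind (rev v) w" using wind_hom_below[OF w(2), of v] wl hv by simp
  moreover have "U < height v" using hv by (simp add: n_def)
  ultimately have "\<not> hom_below U w []" using wind_hom_below[of U w "[]" v] by auto
  moreover have "w \<approx> []" using hom_below_imp_ceq[OF w(2)] l1 by (auto intro: ceq_trans ceq_sym)
  ultimately show ?thesis using w by blast
qed

end

section \<open>Presented groups\<close>

lemma words_append_iff [simp]: "u @ v \<in> words X \<longleftrightarrow> u \<in> words X \<and> v \<in> words X"
  by (auto simp: words_def)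

lemma words_Nil [simp]: "[] \<in> words X"
  by (simp add: words_def)

lemma words_Cons [simp]: "(x, b) # w \<in> words X \<longleftrightarrow> x \<in> X \<and> w \<in> words X"
  by (auto simp: words_def)

lemma pres_rel_words: "(u, v) \<in> pres_rel X R \<Longrightarrow> u \<in> words X \<and> v \<in> words X"
  by (induction rule: pres_rel.induct) auto

lemma equiv_pres_rel: "equiv (words X) (pres_rel X R)"
proof (rule equivI)
  show "pres_rel X R \<subseteq> words X \<times> words X" using pres_rel_words by fast
  show "refl_on (words X) (pres_rel X R)"
    unfolding refl_on_def by (blast intro: pres_rel.refl)
  show "sym (pres_rel X R)" by (rule symI) (rule pres_rel.sym)
  show "trans (pres_rel X R)" by (rule transI) (rule pres_rel.trans)
qed

lemma pres_rel_context:
  assumes "(u, v) \<in> pres_rel X R" and a: "a \<in> words X" and b: "b \<in> words X"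
  shows "(a @ u @ b, a @ v @ b) \<in> pres_rel X R"
  using assms(1)
proof (induction rule: pres_rel.induct)
  case (refl u)
  then show ?case using a b by (intro pres_rel.refl) auto
next
  case (cancel u v x c)
  then show ?case using pres_rel.cancel[of "a @ u" X "v @ b" x c R] a b by simp
next
  case (relator u v r)
  then show ?case using pres_rel.relator[of "a @ u" X "v @ b" r R] a b by simp
qed (blast intro: pres_rel.sym pres_rel.trans)+

lemma pres_rel_append:
  assumes "(u, u') \<in> pres_rel X R" "(v, v') \<in> pres_rel X R"
  shows "(u @ v, u' @ v') \<in> pres_rel X R"
proof (rule pres_rel.trans)
  show "(u @ v, u' @ v) \<in> pres_rel X R"
    using pres_rel_context[OF assms(1), of "[]" v] pres_rel_words[OF assms(2)] by simp
  show "(u' @ v, u' @ v') \<in> pres_rel X R"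
    using pres_rel_context[OF assms(2), of u' "[]"] pres_rel_words[OF assms(1)] by simp
qed

abbreviation word_class :: "'x set \<Rightarrow> 'x word set \<Rightarrow> 'x word \<Rightarrow> 'x word set" where
  "word_class X R w \<equiv> pres_rel X R `` {w}"

lemma word_class_eq_iff:
  "u \<in> words X \<Longrightarrow> v \<in> words X \<Longrightarrow> word_class X R u = word_class X R v \<longleftrightarrow> (u, v) \<in> pres_rel X R"
  using eq_equiv_class_iff[OF equiv_pres_rel] by blast

lemma carrier_presented_group: "carrier (presented_group X R) = word_class X R ` words X"
  by (auto simp: presented_group_def quotient_def)

lemma one_presented_group: "\<one>\<^bsub>presented_group X R\<^esub> = word_class X R []"
  by (simp add: presented_group_def)

lemma mult_presented_group:
  assumes "u \<in> words X" "v \<in> words X"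
  shows "word_class X R u \<otimes>\<^bsub>presented_group X R\<^esub> word_class X R v = word_class X R (u @ v)"
proof -
  have "word_class X R (u' @ v') = word_class X R (u @ v)"
    if "(u, u') \<in> pres_rel X R" "(v, v') \<in> pres_rel X R" for u' v'
    using equiv_class_eq[OF equiv_pres_rel pres_rel_append[OF that]] by simp
  moreover have "(u, u) \<in> pres_rel X R" "(v, v) \<in> pres_rel X R"
    using assms by (auto intro: pres_rel.refl)
  ultimately have "(\<Union>u'\<in>word_class X R u. \<Union>v'\<in>word_class X R v. word_class X R (u' @ v')) =
      word_class X R (u @ v)" by blast
  then show ?thesis by (simp add: presented_group_def)
qed

definition formal_inverse :: "'x word \<Rightarrow> 'x word" where
  "formal_inverse w = rev (map (\<lambda>(x, b). (x, \<not> b)) w)"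

lemma formal_inverse_left:
  "w \<in> words X \<Longrightarrow> formal_inverse w \<in> words X \<and> (formal_inverse w @ w, []) \<in> pres_rel X R"
proof (induction w)
  case Nil
  then show ?case by (auto simp: formal_inverse_def intro: pres_rel.refl)
next
  case (Cons l w)
  obtain x b where l: "l = (x, b)" by force
  have IH: "formal_inverse w \<in> words X" "(formal_inverse w @ w, []) \<in> pres_rel X R"
    using Cons l by auto
  have "(formal_inverse w @ [(x, \<not> b), (x, \<not> \<not> b)] @ w, formal_inverse w @ w) \<in> pres_rel X R"
    using Cons.prems l IH by (intro pres_rel.cancel) auto
  then have "(formal_inverse (l # w) @ l # w, formal_inverse w @ w) \<in> pres_rel X R"
    by (simp add: formal_inverse_def l)
  from pres_rel.trans[OF this IH(2)] show ?case
    using IH(1) Cons.prems l by (simp add: formal_inverse_def)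
qed

lemma group_presented_group: "group (presented_group X R)"
proof (rule groupI)
  let ?P = "presented_group X R"
  show "x \<otimes>\<^bsub>?P\<^esub> y \<in> carrier ?P" if "x \<in> carrier ?P" "y \<in> carrier ?P" for x y
    using that by (auto simp: carrier_presented_group mult_presented_group)
  show "\<one>\<^bsub>?P\<^esub> \<in> carrier ?P" by (auto simp: carrier_presented_group one_presented_group)
  show "x \<otimes>\<^bsub>?P\<^esub> y \<otimes>\<^bsub>?P\<^esub> z = x \<otimes>\<^bsub>?P\<^esub> (y \<otimes>\<^bsub>?P\<^esub> z)"
    if "x \<in> carrier ?P" "y \<in> carrier ?P" "z \<in> carrier ?P" for x y z
    using that by (auto simp: carrier_presented_group mult_presented_group)
  show "\<one>\<^bsub>?P\<^esub> \<otimes>\<^bsub>?P\<^esub> x = x" if "x \<in> carrier ?P" for x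
    using that by (auto simp: carrier_presented_group one_presented_group mult_presented_group)
  show "\<exists>y\<in>carrier ?P. y \<otimes>\<^bsub>?P\<^esub> x = \<one>\<^bsub>?P\<^esub>" if "x \<in> carrier ?P" for x
  proof -
    from that obtain w where w: "w \<in> words X" "x = word_class X R w"
      by (auto simp: carrier_presented_group)
    note inv = formal_inverse_left[OF w(1), of R]
    have "word_class X R (formal_inverse w) \<otimes>\<^bsub>?P\<^esub> x = \<one>\<^bsub>?P\<^esub>"
      using inv w by (simp add: mult_presented_group one_presented_group word_class_eq_iff)
    then show ?thesis using inv by (auto simp: carrier_presented_group)
  qed
qed

section \<open>Cayley graphs of right-angled Coxeter groups\<close>

text \<open>A group whose elements are words with involutive generators up to the moves above; \<open>ev\<close> evaluates
  a word in the group.\<close>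
locale word_group = commutation_graph E + group G
  for E :: "'a \<Rightarrow> 'a \<Rightarrow> bool" and G :: "('g, 'c) monoid_scheme" (structure) +
  fixes V :: "'a set" and ev :: "'a list \<Rightarrow> 'g"
  assumes carrier_ev: "carrier G = ev ` lists V"
    and ev_Nil: "ev [] = \<one>"
    and ev_append: "u \<in> lists V \<Longrightarrow> v \<in> lists V \<Longrightarrow> ev (u @ v) = ev u \<otimes> ev v"
    and ev_eq_iff: "u \<in> lists V \<Longrightarrow> v \<in> lists V \<Longrightarrow> ev u = ev v \<longleftrightarrow> u \<approx> v"
    and finite_letters: "finite V"

text \<open>The relators \<open>s s\<close> make the signs of letters irrelevant, so positive words suffice, and the
  commutators become commutations.\<close>
lemma word_group_racg:
  assumes "pair_graph \<Delta>"
  shows "word_group (\<lambda>s t. (s, t) \<in> parcs \<Delta>) (racg \<Delta>) (pverts \<Delta>)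
    (\<lambda>w. word_class (pverts \<Delta>) (racg_relators \<Delta>) (map (\<lambda>s. (s, True)) w))"
proof -
  interpret \<Delta>: pair_graph \<Delta> by fact
  define V where "V = pverts \<Delta>"
  define R where "R = racg_relators \<Delta>"
  define pos_word :: "'a list \<Rightarrow> 'a word" where "pos_word = map (\<lambda>s. (s, True))"
  interpret commutation_graph "\<lambda>s t. (s, t) \<in> parcs \<Delta>"
  proof
    show "(t, s) \<in> parcs \<Delta>" if "(s, t) \<in> parcs \<Delta>" for s t
      using that \<Delta>.pair_sym_arcs by (auto simp: symmetric_def dest: symD)
    show "(s, s) \<notin> parcs \<Delta>" for s using \<Delta>.pair_no_loops by fastforce
  qed
  have arc: "s \<in> V \<and> t \<in> V" if "(s, t) \<in> parcs \<Delta>" for s t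
    using that \<Delta>.arc_fst_in_verts \<Delta>.arc_snd_in_verts by (fastforce simp: V_def)
  have pw: "pos_word w \<in> words V \<longleftrightarrow> w \<in> lists V" for w
    by (auto simp: pos_word_def words_def in_lists_conv_set)
  have pw_app: "pos_word (u @ v) = pos_word u @ pos_word v" for u v by (simp add: pos_word_def)
  have square: "(u @ [(s, True), (s, True)] @ v, u @ v) \<in> pres_rel V R"
    if "s \<in> V" "u \<in> words V" "v \<in> words V" for u v s
    using that by (intro pres_rel.relator) (auto simp: R_def racg_relators_def V_def)
  have flip_sign: "([(s, b)], [(s, True)]) \<in> pres_rel V R" if "s \<in> V" for s b
  proof (cases b)
    case True
    then show ?thesis using that by (auto intro: pres_rel.refl)
  next
    case False
    have "([(s, False)] @ [(s, True), (s, True)] @ [], [(s, False)] @ []) \<in> pres_rel V R"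
      using that by (intro square) auto
    moreover have "([] @ [(s, False), (s, \<not> False)] @ [(s, True)], [] @ [(s, True)]) \<in> pres_rel V R"
      using that by (intro pres_rel.cancel) auto
    ultimately show ?thesis
      using False pres_rel.trans[OF pres_rel.sym, of "[(s, False)] @ [(s, True), (s, True)] @ []"]
      by simp
  qed
  have positive: "(w, pos_word (map fst w)) \<in> pres_rel V R" if "w \<in> words V" for w
    using that
  proof (induction w)
    case Nil
    then show ?case by (auto simp: pos_word_def intro: pres_rel.refl)
  next
    case (Cons l w)
    obtain s b where l: "l = (s, b)" by force
    then have "([(s, b)] @ w, [(s, True)] @ pos_word (map fst w)) \<in> pres_rel V R"
      using Cons flip_sign by (intro pres_rel_append) auto
    then show ?case by (simp add: l pos_word_def)
  qed
  have to_ceq: "ceq (map fst u) (map fst v)" if "(u, v) \<in> pres_rel V R" for u v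
    using that
  proof (induction rule: pres_rel.induct)
    case (cancel u v x b)
    then show ?case using ceq_cancel[of "map fst u" x "map fst v"] by simp
  next
    case (relator u v r)
    consider s where "r = [(s, True), (s, True)]"
      | s t where "(s, t) \<in> parcs \<Delta>" "r = [(s, True), (t, True), (s, False), (t, False)]"
      using relator by (auto simp: R_def racg_relators_def)
    then show ?case
    proof cases
      case 1
      then show ?thesis using ceq_cancel[of "map fst u" _ "map fst v"] by simp
    next
      case (2 s t)
      have "ceq (map fst u @ [s, t, s, t] @ map fst v) (map fst u @ [t, s, s, t] @ map fst v)"
        using ceq_comm[OF 2(1), of "map fst u" "[s, t] @ map fst v"] by simp
      also have "ceq \<dots> (map fst u @ [t, t] @ map fst v)"
        using ceq_cancel[of "map fst u @ [t]" s "[t] @ map fst v"] by simp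
      also have "ceq \<dots> (map fst u @ map fst v)" by (rule ceq_cancel)
      finally show ?thesis using 2 by simp
    qed
  qed (auto intro: ceq_sym ceq_trans)
  have swap: "(pos_word [s, t], pos_word [t, s]) \<in> pres_rel V R" if st: "(s, t) \<in> parcs \<Delta>" for s t
  proof -
    have V: "s \<in> V" "t \<in> V" using arc st by auto
    define r where "r = [(s, True), (t, True), (s, False), (t, False)]"
    have "([] @ r @ [(t, True), (s, True)], [] @ [(t, True), (s, True)]) \<in> pres_rel V R"
      using V st by (intro pres_rel.relator) (auto simp: r_def R_def racg_relators_def)
    moreover have "([(s, True), (t, True), (s, False)] @ [(t, False), (t, \<not> False)] @ [(s, True)],
        [(s, True), (t, True), (s, False)] @ [(s, True)]) \<in> pres_rel V R"
      using V by (intro pres_rel.cancel) auto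
    moreover have "([(s, True), (t, True)] @ [(s, False), (s, \<not> False)] @ [],
        [(s, True), (t, True)] @ []) \<in> pres_rel V R"
      using V by (intro pres_rel.cancel) auto
    ultimately show ?thesis
      by (simp add: r_def pos_word_def) (meson pres_rel.sym pres_rel.trans)
  qed
  \<comment> \<open>Letters outside the vertex set may occur in a chain of moves; they are filtered out.\<close>
  have from_ceq: "(pos_word (filter (\<lambda>s. s \<in> V) u), pos_word (filter (\<lambda>s. s \<in> V) v)) \<in> pres_rel V R"
    if "ceq u v" for u v
    using that
  proof (induction rule: ceq.induct)
    case (ceq_refl u)
    then show ?case using pw by (intro pres_rel.refl) auto
  next
    case (ceq_cancel u s v)
    let ?f = "filter (\<lambda>s. s \<in> V)"
    have w: "pos_word (?f u) \<in> words V" "pos_word (?f v) \<in> words V" using pw by auto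
    show ?case
    proof (cases "s \<in> V")
      case True
      then show ?thesis using square[OF True w] by (simp add: pos_word_def)
    next
      case False
      then show ?thesis using w by (auto simp: pos_word_def intro!: pres_rel.refl)
    qed
  next
    case (ceq_comm s t u v)
    let ?f = "filter (\<lambda>s. s \<in> V)"
    have w: "pos_word (?f u) \<in> words V" "pos_word (?f v) \<in> words V" using pw by auto
    show ?case
      using pres_rel_context[OF swap[OF ceq_comm] w] arc[OF ceq_comm] by (simp add: pos_word_def)
  qed (blast intro: pres_rel.sym pres_rel.trans)+
  have ev_iff: "word_class V R (pos_word u) = word_class V R (pos_word v) \<longleftrightarrow> ceq u v"
    if "u \<in> lists V" "v \<in> lists V" for u v
  proof -
    have "filter (\<lambda>s. s \<in> V) u = u" "filter (\<lambda>s. s \<in> V) v = v"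
      using that by (auto simp: in_lists_conv_set filter_id_conv)
    then have "(pos_word u, pos_word v) \<in> pres_rel V R \<longleftrightarrow> ceq u v"
      using from_ceq[of u v] to_ceq[of "pos_word u" "pos_word v"]
      by (auto simp: pos_word_def comp_def)
    then show ?thesis using that pw by (simp add: word_class_eq_iff)
  qed
  have "word_class V R ` words V = (\<lambda>w. word_class V R (pos_word w)) ` lists V"
  proof (intro equalityI subsetI)
    fix x assume "x \<in> word_class V R ` words V"
    then obtain w where w: "w \<in> words V" "x = word_class V R w" by blast
    then have "x = word_class V R (pos_word (map fst w))"
      using equiv_class_eq[OF equiv_pres_rel positive[OF w(1)]] by simp
    moreover have "map fst w \<in> lists V" using w(1) by (fastforce simp: words_def)
    ultimately show "x \<in> (\<lambda>w. word_class V R (pos_word w)) ` lists V" by blast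
  qed (use pw in auto)
  moreover have G: "racg \<Delta> = presented_group V R" by (simp add: racg_def V_def R_def)
  ultimately have "word_group (\<lambda>s t. (s, t) \<in> parcs \<Delta>) (racg \<Delta>) V (\<lambda>w. word_class V R (pos_word w))"
    unfolding G
  proof (intro word_group.intro word_group_axioms.intro)
    show "word_class V R (pos_word (u @ v)) =
        word_class V R (pos_word u) \<otimes>\<^bsub>presented_group V R\<^esub> word_class V R (pos_word v)"
      if "u \<in> lists V" "v \<in> lists V" for u v
      using that by (simp only: mult_presented_group pw pw_app)
    show "finite V" unfolding V_def by (rule \<Delta>.pair_finite_verts)
    show "word_class V R (pos_word []) = \<one>\<^bsub>presented_group V R\<^esub>"
      by (simp add: one_presented_group pos_word_def)
  qed (simp_all only: carrier_presented_group ev_iff group_presented_group commutation_graph_axioms)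
  then show ?thesis by (simp only: V_def R_def pos_word_def)
qed

context word_group
begin

lemma ev_in_carrier [simp]: "w \<in> lists V \<Longrightarrow> ev w \<in> carrier G"
  by (simp add: carrier_ev)

lemma ev_rev: "w \<in> lists V \<Longrightarrow> ev (rev w) = inv (ev w)"
proof -
  assume w: "w \<in> lists V"
  then have r: "rev w \<in> lists V" by (auto simp: in_lists_conv_set)
  have "ev (rev w) \<otimes> ev w = \<one>"
    using ev_append[OF r w] ev_eq_iff[of "rev w @ w" "[]"] rev_left_inverse[of w] w r ev_Nil by simp
  then show ?thesis using inv_equality[of "ev (rev w)" "ev w"] w r by simp
qed

abbreviation gens :: "'g set" where
  "gens \<equiv> (\<lambda>s. ev [s]) ` V"

lemma generate_gens: "generate G gens = carrier G"
proof
  show "generate G gens \<subseteq> carrier G" by (rule generate_incl) auto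
  have "ev w \<in> generate G gens" if "w \<in> lists V" for w
    using that
  proof (induction w)
    case Nil
    then show ?case by (simp add: ev_Nil generate.one)
  next
    case (Cons s w)
    then have "ev (s # w) = ev [s] \<otimes> ev w" using ev_append[of "[s]" w] by auto
    moreover have "s \<in> V" using Cons by blast
    then have "ev [s] \<in> gens" by blast
    then have "ev [s] \<in> generate G gens" by (rule generate.incl)
    moreover have "ev w \<in> generate G gens" using Cons by blast
    ultimately show ?case using generate.eng by metis
  qed
  then show "carrier G \<subseteq> generate G gens" by (auto simp: carrier_ev)
qed

abbreviation Cay :: "('g, 'g \<times> 'g) pre_digraph" where
  "Cay \<equiv> with_proj (cayley_graph G gens)"

lemma Cay_arc_iff:
  assumes "g \<in> lists V"
  shows "(ev g, y) \<in> arcs Cay \<longleftrightarrow> (\<exists>s\<in>V. y = ev (g @ [s]))"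
proof
  assume "(ev g, y) \<in> arcs Cay"
  then obtain s where s: "s \<in> V" "y \<in> carrier G" "y = ev g \<otimes> ev [s] \<or> ev g = y \<otimes> ev [s]"
    by (auto simp: cayley_graph_def)
  from s(3) show "\<exists>s\<in>V. y = ev (g @ [s])"
  proof
    assume "ev g = y \<otimes> ev [s]"
    then have "ev g \<otimes> ev [s] = y \<otimes> (ev [s] \<otimes> ev [s])" using s by (simp add: m_assoc)
    moreover have "ev [s] \<otimes> ev [s] = \<one>"
      using ev_append[of "[s]" "[s]"] ev_eq_iff[of "[s, s]" "[]"] ceq_cancel[of "[]" s "[]"] s ev_Nil
      by simp
    ultimately have "y = ev (g @ [s])" using s assms ev_append[of g "[s]"] by auto
    then show ?thesis using s(1) by blast
  next
    assume "y = ev g \<otimes> ev [s]"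
    then have "y = ev (g @ [s])" using s assms ev_append[of g "[s]"] by auto
    then show ?thesis using s(1) by blast
  qed
next
  assume "\<exists>s\<in>V. y = ev (g @ [s])"
  then show "(ev g, y) \<in> arcs Cay"
  proof
    fix s assume s: "s \<in> V" "y = ev (g @ [s])"
    then have "y = ev g \<otimes> ev [s]" "y \<in> carrier G"
      using assms ev_append[of g "[s]"] ev_in_carrier[of "g @ [s]"] by simp_all
    then show ?thesis using s(1) assms by (auto simp: cayley_graph_def)
  qed
qed

fun walk :: "'a list \<Rightarrow> 'a list \<Rightarrow> ('g \<times> 'g) list" where
  "walk g [] = []"
| "walk g (s # w) = (ev g, ev (g @ [s])) # walk (g @ [s]) w"

lemma length_walk [simp]: "length (walk g w) = length w"
  by (induction w arbitrary: g) auto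

lemma awalk_walk:
  "g \<in> lists V \<Longrightarrow> w \<in> lists V \<Longrightarrow> pre_digraph.awalk Cay (ev g) (walk g w) (ev (g @ w))"
proof (induction w arbitrary: g)
  case Nil
  then show ?case by (simp add: pre_digraph.awalk_def pre_digraph.cas.simps cayley_graph_def)
next
  case (Cons s w)
  then have "pre_digraph.awalk Cay (ev (g @ [s])) (walk (g @ [s]) w) (ev ((g @ [s]) @ w))"
    using Cons.IH[of "g @ [s]"] by auto
  moreover have "(ev g, ev (g @ [s])) \<in> arcs Cay" using Cons Cay_arc_iff by auto
  ultimately show ?case
    using Cons.prems by (auto simp: pre_digraph.awalk_def pre_digraph.cas.simps cayley_graph_def)
qed

lemma awalk_imp_walk:
  "g \<in> lists V \<Longrightarrow> pre_digraph.awalk Cay (ev g) p y \<Longrightarrow>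
    \<exists>w\<in>lists V. p = walk g w \<and> y = ev (g @ w)"
proof (induction p arbitrary: g)
  case Nil
  then show ?case
    by (intro bexI[of _ "[]"]) (auto simp: pre_digraph.awalk_def pre_digraph.cas.simps)
next
  case (Cons e p)
  have e: "fst e = ev g" "e \<in> arcs Cay"
    using Cons.prems(2) by (auto simp: pre_digraph.awalk_def pre_digraph.cas.simps)
  then have "(ev g, snd e) \<in> arcs Cay" by (metis prod.collapse)
  then obtain s where s: "s \<in> V" "snd e = ev (g @ [s])"
    using Cay_arc_iff[OF Cons.prems(1)] by blast
  have "pre_digraph.awalk Cay (ev (g @ [s])) p y"
    using Cons.prems s by (auto simp: pre_digraph.awalk_def pre_digraph.cas.simps cayley_graph_def)
  then obtain w where "w \<in> lists V" "p = walk (g @ [s]) w" "y = ev ((g @ [s]) @ w)"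
    using Cons.IH[of "g @ [s]"] Cons.prems(1) s(1) by auto
  moreover have "e = (ev g, ev (g @ [s]))" using e(1) s(2) by (metis prod.collapse)
  ultimately show ?case using s(1) by (intro bexI[of _ "s # w"]) auto
qed

lemma awalk_verts_walk:
  "set (pre_digraph.awalk_verts Cay (ev g) (walk g w)) = {ev (g @ take i w) |i. i \<le> length w}"
proof (induction w arbitrary: g)
  case Nil
  then show ?case by (simp add: pre_digraph.awalk_verts.simps)
next
  case (Cons s w)
  have "{ev (g @ take i (s # w)) |i. i \<le> length (s # w)} =
      insert (ev g) {ev ((g @ [s]) @ take i w) |i. i \<le> length w}"
  proof (intro equalityI subsetI)
    fix x assume "x \<in> {ev (g @ take i (s # w)) |i. i \<le> length (s # w)}"
    then obtain i where "i \<le> length (s # w)" "x = ev (g @ take i (s # w))" by blast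
    then show "x \<in> insert (ev g) {ev ((g @ [s]) @ take i w) |i. i \<le> length w}"
      by (cases i) auto
  next
    fix x assume "x \<in> insert (ev g) {ev ((g @ [s]) @ take i w) |i. i \<le> length w}"
    then consider "x = ev g" | i where "i \<le> length w" "x = ev ((g @ [s]) @ take i w)" by blast
    then show "x \<in> {ev (g @ take i (s # w)) |i. i \<le> length (s # w)}"
    proof cases
      case 1
      then show ?thesis by (auto intro!: exI[of _ 0])
    next
      case (2 i)
      then show ?thesis by (auto intro!: exI[of _ "Suc i"])
    qed
  qed
  then show ?case using Cons[of "g @ [s]"] by (simp add: pre_digraph.awalk_verts.simps)
qed

lemma geodesic_walk_iff:
  assumes g: "g \<in> lists V" and w: "w \<in> lists V"
  shows "geodesic Cay (ev g) (walk g w) (ev (g @ w)) \<longleftrightarrow> reduced w"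
proof
  assume geo: "geodesic Cay (ev g) (walk g w) (ev (g @ w))"
  show "reduced w"
  proof (rule reduced_if_geodesic)
    fix u assume u: "u \<approx> w" "set u \<subseteq> set w"
    then have uV: "u \<in> lists V" using w by (auto simp: in_lists_conv_set)
    have "ev (g @ u) = ev (g @ w)" using u g w uV by (simp add: ev_eq_iff ceq_append)
    then have "pre_digraph.awalk Cay (ev g) (walk g u) (ev (g @ w))" using awalk_walk[OF g uV]
      by simp
    then show "length w \<le> length u" using geo by (auto simp: geodesic_def)
  qed
next
  assume reduced: "reduced w"
  have "length w \<le> length p" if "pre_digraph.awalk Cay (ev g) p (ev (g @ w))" for p
  proof -
    obtain u where u: "u \<in> lists V" "p = walk g u" "ev (g @ w) = ev (g @ u)"
      using awalk_imp_walk[OF g \<open>pre_digraph.awalk Cay (ev g) p _\<close>] by blast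
    then have "g @ w \<approx> g @ u" using g w ev_eq_iff[of "g @ w" "g @ u"] by simp
    then have "u \<approx> w" unfolding ceq_cancel_left by (rule ceq_sym)
    then show ?thesis using reduced_imp_geodesic[OF reduced] u by simp
  qed
  then show "geodesic Cay (ev g) (walk g w) (ev (g @ w))"
    using awalk_walk[OF g w] by (auto simp: geodesic_def)
qed

lemma geodesicD:
  assumes "g \<in> lists V" "geodesic Cay (ev g) p y"
  shows "\<exists>w\<in>lists V. p = walk g w \<and> y = ev (g @ w) \<and> reduced w"
proof -
  have "pre_digraph.awalk Cay (ev g) p y" using assms(2) by (simp add: geodesic_def)
  then obtain w where w: "w \<in> lists V" "p = walk g w" "y = ev (g @ w)"
    using awalk_imp_walk[OF assms(1)] by blast
  then have "reduced w" using assms(2) geodesic_walk_iff[OF assms(1) w(1)] by simp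
  then show ?thesis using w by blast
qed

lemma nbhdI:
  assumes "g \<in> lists V" "d \<in> lists V" "length d \<le> K" "ev g \<in> A"
  shows "ev (g @ d) \<in> nbhd Cay K A"
  using awalk_walk[OF assms(1,2)] assms(3,4) unfolding nbhd_def by force

lemma nbhdD:
  assumes "x \<in> nbhd Cay K A" "A \<subseteq> carrier G"
  shows "\<exists>g\<in>lists V. \<exists>d\<in>lists V. ev g \<in> A \<and> length d \<le> K \<and> x = ev (g @ d)"
proof -
  obtain y q where y: "y \<in> A" "pre_digraph.awalk Cay y q x" "length q \<le> K"
    using assms(1) by (auto simp: nbhd_def)
  then obtain g where g: "g \<in> lists V" "y = ev g" using assms(2) by (auto simp: carrier_ev)
  then obtain w where "w \<in> lists V" "q = walk g w" "x = ev (g @ w)"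
    using awalk_imp_walk y(2) by blast
  then show ?thesis using y g by auto
qed

text \<open>A triangle of geodesic edge paths is read off as three reduced words with trivial product, and
  \<open>slim_words\<close> is translated back.\<close>
lemma hyperbolic_if_girth_five:
  assumes "girth_five_graph E"
  shows "hyperbolic_group G"
proof -
  interpret girth_five_graph E by fact
  have "slim_triangles Cay 4"
    unfolding slim_triangles_def
  proof (intro allI impI subsetI, elim conjE)
    fix x y z p q r a
    assume geo: "geodesic Cay x p y" "geodesic Cay y q z" "geodesic Cay z r x"
      and a: "a \<in> set (pre_digraph.awalk_verts Cay x p)"
    let ?A = "set (pre_digraph.awalk_verts Cay y q) \<union> set (pre_digraph.awalk_verts Cay z r)"
    have "x \<in> carrier G"
      using geo(1) by (auto simp: geodesic_def pre_digraph.awalk_def cayley_graph_def)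
    then obtain g where g: "g \<in> lists V" "x = ev g" by (auto simp: carrier_ev)
    obtain wp where p: "wp \<in> lists V" "p = walk g wp" "y = ev (g @ wp)" "reduced wp"
      using geodesicD[OF g(1) geo(1)[unfolded g(2)]] by blast
    have gp: "g @ wp \<in> lists V" using g(1) p(1) by simp
    obtain wq where q: "wq \<in> lists V" "q = walk (g @ wp) wq" "z = ev ((g @ wp) @ wq)" "reduced wq"
      using geodesicD[OF gp geo(2)[unfolded p(3)]] by blast
    have gpq: "(g @ wp) @ wq \<in> lists V" using g(1) p(1) q(1) by simp
    obtain wr where r: "wr \<in> lists V" "r = walk ((g @ wp) @ wq) wr"
        "x = ev (((g @ wp) @ wq) @ wr)" "reduced wr"
      using geodesicD[OF gpq geo(3)[unfolded q(3)]] by blast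
    have "((g @ wp) @ wq) @ wr \<in> lists V" using g(1) p(1) q(1) r(1) by simp
    from ev_eq_iff[OF g(1) this] r(3)[unfolded g(2)]
    have "g \<approx> ((g @ wp) @ wq) @ wr" by blast
    then have "g @ [] \<approx> g @ (wp @ wq @ wr)" by simp
    then have closed: "wp @ wq @ wr \<approx> []" unfolding ceq_cancel_left by (rule ceq_sym)
    obtain i where i: "i \<le> length wp" "a = ev (g @ take i wp)"
      using a unfolding p(2) g(2) awalk_verts_walk by blast
    have letters: "set wp \<union> set wq \<union> set wr \<subseteq> V" using p(1) q(1) r(1) by auto
    obtain d where d: "d \<in> lists V" "length d \<le> 4"
      "(\<exists>j\<le>length wq. take i wp \<approx> wp @ take j wq @ d) \<or>
       (\<exists>j\<le>length wr. take i wp \<approx> wp @ wq @ take j wr @ d)"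
      using slim_words[OF p(4) q(4) r(4) closed letters i(1)] by blast
    have tV: "take j w \<in> lists V" if "w \<in> lists V" for j w
      using that set_take_subset[of j w] by (auto simp: in_lists_conv_set)
    have near: "a \<in> nbhd Cay 4 ?A" if "h \<in> lists V" "ev h \<in> ?A" "g @ take i wp \<approx> h @ d" for h
    proof -
      have "a = ev (h @ d)"
        using i(2) that(1,3) ev_eq_iff[of "g @ take i wp" "h @ d"] g(1) d(1) tV[OF p(1), of i]
          by simp
      then show ?thesis using nbhdI[OF that(1) d(1,2) that(2)] by simp
    qed
    from d(3) show "a \<in> nbhd Cay 4 ?A"
    proof (elim disjE exE conjE)
      fix j assume j: "j \<le> length wq" "take i wp \<approx> wp @ take j wq @ d"
      have "ev ((g @ wp) @ take j wq) \<in> ?A"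
        unfolding q(2) p(3) awalk_verts_walk using j(1) by blast
      then show ?thesis
        using near[of "(g @ wp) @ take j wq"] ceq_append[OF ceq_refl[of g] j(2)]
          g(1) p(1) tV[OF q(1), of j] by simp
    next
      fix j assume j: "j \<le> length wr" "take i wp \<approx> wp @ wq @ take j wr @ d"
      have "ev (((g @ wp) @ wq) @ take j wr) \<in> ?A"
        unfolding r(2) q(3) awalk_verts_walk using j(1) by blast
      then show ?thesis
        using near[of "((g @ wp) @ wq) @ take j wr"] ceq_append[OF ceq_refl[of g] j(2)]
          g(1) p(1) q(1) tV[OF r(1), of j] by simp
    qed
  qed
  moreover have "finite gens" using finite_letters by simp
  moreover have "gens \<subseteq> carrier G" by auto
  ultimately show ?thesis
    unfolding hyperbolic_group_def using generate_gens is_group by blast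
qed

end

section \<open>The level subgroup\<close>

locale fibred_word_group = word_group E G V ev + morse_graph E V horizontal par
  for E :: "'a \<Rightarrow> 'a \<Rightarrow> bool" and G :: "('g, 'c) monoid_scheme" (structure)
    and V :: "'a set" and ev :: "'a list \<Rightarrow> 'g" and horizontal par :: "'a \<Rightarrow> bool"
begin

definition level_subgroup :: "'g set" where
  "level_subgroup = ev ` {w \<in> lists V. level_word w}"

lemma ev_in_level_subgroup_iff: "w \<in> lists V \<Longrightarrow> ev w \<in> level_subgroup \<longleftrightarrow> level_word w"
  using ev_eq_iff level_word_ceq unfolding level_subgroup_def by blast

lemma rev_in_lists: "w \<in> lists V \<Longrightarrow> rev w \<in> lists V"
  by (auto simp: in_lists_conv_set)

lemma subgroup_level_subgroup: "subgroup level_subgroup G"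
proof (rule subgroupI)
  show "level_subgroup \<subseteq> carrier G" unfolding level_subgroup_def using ev_in_carrier by blast
  show "level_subgroup \<noteq> {}" unfolding level_subgroup_def using level_word_Nil by blast
  show "inv x \<in> level_subgroup" if x: "x \<in> level_subgroup" for x
  proof -
    from x obtain w where "w \<in> lists V" "level_word w" "x = ev w" by (auto simp: level_subgroup_def)
    then show ?thesis
      using ev_rev[of w] level_word_rev[of w] rev_in_lists[of w] ev_in_level_subgroup_iff[of "rev w"]
        by simp
  qed
  show "x \<otimes> y \<in> level_subgroup" if "x \<in> level_subgroup" "y \<in> level_subgroup" for x y
  proof -
    from that obtain u v where "u \<in> lists V" "level_word u" "x = ev u" "v \<in> lists V" "level_word v" "y = ev v"
      by (auto simp: level_subgroup_def)
    then show ?thesis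
      using ev_append[of u v] level_word_append[of u v] ev_in_level_subgroup_iff[of "u @ v"] by simp
  qed
qed

lemma level_subgroup_subset: "level_subgroup \<subseteq> carrier G"
  using subgroup_level_subgroup subgroup.subset by blast

lemma short_genD: "w \<in> short_gens \<Longrightarrow> w \<in> lists V \<and> level_word w"
  by (auto simp: short_gens_def)

lemma concat_short_gens: "ts \<in> lists short_gens \<Longrightarrow> concat ts \<in> lists V"
  by (induction ts) (auto dest: short_genD)

lemma finitely_generated_level_subgroup: "finitely_generated (G\<lparr>carrier := level_subgroup\<rparr>)"
  unfolding finitely_generated_def
proof (intro exI[of _ "ev ` short_gens"] conjI)
  let ?S = "ev ` short_gens"
  show "finite ?S" using finite_short_gens by simp
  have S: "?S \<subseteq> level_subgroup" by (auto simp: level_subgroup_def dest: short_genD)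
  then show "?S \<subseteq> carrier (G\<lparr>carrier := level_subgroup\<rparr>)" by simp
  have gen: "ev (concat ts) \<in> generate G ?S" if "ts \<in> lists short_gens" for ts
    using that
  proof (induction ts rule: lists.induct)
    case Nil
    then show ?case by (simp add: ev_Nil generate.one)
  next
    case (Cons t ts)
    have "ev (concat (t # ts)) = ev t \<otimes> ev (concat ts)"
      using ev_append[of t "concat ts"] short_genD[OF Cons(1)] concat_short_gens[OF Cons(2)] by simp
    moreover have "ev t \<in> generate G ?S" by (rule generate.incl) (use Cons(1) in blast)
    ultimately show ?case using generate.eng[OF _ Cons(3)] by simp
  qed
  have "level_subgroup \<subseteq> generate G ?S"
  proof
    fix x assume "x \<in> level_subgroup"
    then obtain w where w: "w \<in> lists V" "level_word w" "x = ev w"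
      by (auto simp: level_subgroup_def)
    then obtain ts where "ts \<in> lists short_gens" "concat ts \<approx> w" using short_gens_generate by blast
    then show "x \<in> generate G ?S"
      using gen[of ts] ev_eq_iff[OF concat_short_gens[of ts] w(1)] w(3) by simp
  qed
  then have "generate G ?S = level_subgroup"
    using generate_subgroup_incl[OF S subgroup_level_subgroup]
    by blast
  then show "generate (G\<lparr>carrier := level_subgroup\<rparr>) ?S = carrier (G\<lparr>carrier := level_subgroup\<rparr>)"
    using generate_consistent[OF S subgroup_level_subgroup] by simp
qed

text \<open>A vertex at distance at most \<open>K\<close> from the subgroup has height at most \<open>K\<close>, whereas the geodesic
  \<open>climb n @ sink n\<close> passes through height \<open>n\<close>.\<close>
lemma not_quasiconvex_level_subgroup: "\<not> quasiconvex G gens level_subgroup"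
proof
  assume "quasiconvex G gens level_subgroup"
  then obtain K where K: "\<And>h h' p. h \<in> level_subgroup \<Longrightarrow> h' \<in> level_subgroup \<Longrightarrow> geodesic Cay h p h' \<Longrightarrow>
      set (pre_digraph.awalk_verts Cay h p) \<subseteq> nbhd Cay K level_subgroup"
    unfolding quasiconvex_def by blast
  define n where "n = 2 * (K + 1)"
  define w where "w = climb n @ sink n"
  have w: "w \<in> lists V" using climb(1) sink(1) by (simp add: w_def)
  have "ev [] \<in> level_subgroup" using ev_in_level_subgroup_iff[of "[]"] by simp
  moreover have "ev w \<in> level_subgroup"
    using ev_in_level_subgroup_iff[OF w] level_word_climb_sink[of n]
    by (simp add: w_def n_def)
  moreover have "geodesic Cay (ev []) (walk [] w) (ev ([] @ w))"
    using geodesic_walk_iff[of "[]" w] w reduced_climb_sink[of n] by (simp add: w_def)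
  ultimately have sub: "set (pre_digraph.awalk_verts Cay (ev []) (walk [] w)) \<subseteq> nbhd Cay K level_subgroup"
    using K[of "ev []" "ev w" "walk [] w"] by simp
  have "ev ([] @ take n w) \<in> set (pre_digraph.awalk_verts Cay (ev []) (walk [] w))"
    unfolding awalk_verts_walk using length_climb[of n] by (auto simp: w_def intro!: exI[of _ n])
  then have "ev (climb n) \<in> nbhd Cay K level_subgroup" using sub length_climb[of n]
    by (auto simp: w_def)
  then obtain g d where gd: "g \<in> lists V" "d \<in> lists V" "ev g \<in> level_subgroup" "length d \<le> K"
      "ev (climb n) = ev (g @ d)"
    using nbhdD[OF _ level_subgroup_subset] by blast
  have gdV: "g @ d \<in> lists V" using gd(1,2) by simp
  have "climb n \<approx> g @ d" using gd(5) ev_eq_iff[OF climb(1) gdV] by blast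
  moreover have "level_word g" using gd(1,3) ev_in_level_subgroup_iff by blast
  ultimately have "int n = height d"
    using height_ceq[of "climb n" "g @ d"] height_level_word_append[of g d] height_climb[of n]
      by simp
  then show False using height_le_length[of d] gd(4) by (simp add: n_def)
qed

lemma uniform_hom_below:
  assumes "finite A" "\<And>x. x \<in> A \<Longrightarrow> f x \<approx> g x"
  shows "\<exists>U. \<forall>x\<in>A. hom_below U (f x) (g x)"
  using assms
proof (induction A rule: finite_induct)
  case (insert x A)
  then obtain U where U: "\<forall>x\<in>A. hom_below U (f x) (g x)" by auto
  obtain U' where "hom_below U' (f x) (g x)" using ceq_imp_hom_below insert.prems by blast
  then have "\<forall>y\<in>insert x A. hom_below (max U U') (f y) (g y)"
    using U by (auto intro: hom_below_mono)
  then show ?case ..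
qed simp

text \<open>Generators of a finite presentation are replaced by paths, and relators by loops. Each of the
  finitely many relator loops, and each of the finitely many loops that express a short generator
  by the new generators, contracts below some height. Translates of these loops by the subgroup
  contract below the same height, and every loop in the strip is a composition of such translates.\<close>
lemma finitely_presentable_imp_null_homotopies:
  assumes "finitely_presentable (G\<lparr>carrier := level_subgroup\<rparr>)"
  shows "\<exists>U. \<forall>w\<in>lists V. confined 0 1 [] w \<longrightarrow> w \<approx> [] \<longrightarrow> hom_below U w []"
proof -
  let ?K = "G\<lparr>carrier := level_subgroup\<rparr>"
  obtain n :: nat and R where R: "finite R" "R \<subseteq> words {..<n}"
    and iso: "?K \<cong> presented_group {..<n} R"
    using assms unfolding finitely_presentable_def by blast
  define X where "X = {..<n}"
  let ?P = "presented_group X R"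
  interpret K: group ?K by (rule subgroup.subgroup_is_group[OF subgroup_level_subgroup is_group])
  interpret P: group ?P by (rule group_presented_group)
  obtain \<psi> where \<psi>: "\<psi> \<in> iso ?P ?K"
    using K.iso_sym[OF iso] unfolding is_iso_def X_def by blast
  then have hom: "\<psi> (x \<otimes>\<^bsub>?P\<^esub> y) = \<psi> x \<otimes> \<psi> y" "\<psi> x \<in> level_subgroup"
      if "x \<in> carrier ?P" "y \<in> carrier ?P" for x y
    using that by (auto simp: iso_def hom_def)
  have bij: "inj_on \<psi> (carrier ?P)" "\<psi> ` carrier ?P = level_subgroup"
    using \<psi> by (auto simp: iso_def bij_betw_def)
  have cl: "word_class X R w \<in> carrier ?P" if "w \<in> words X" for w
    using that by (simp add: carrier_presented_group)
  define ev' where "ev' w = \<psi> (word_class X R w)" for w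
  have ev': "ev' (u @ v) = ev' u \<otimes> ev' v" if "u \<in> words X" "v \<in> words X" for u v
    using that hom(1)[OF cl cl] by (simp add: ev'_def mult_presented_group)
  have ev'_H: "ev' w \<in> level_subgroup" if "w \<in> words X" for w
    using hom(2)[OF cl cl] that by (simp add: ev'_def)
  have ev'_Nil: "ev' [] = \<one>"
  proof -
    have "ev' [] \<otimes> ev' [] = ev' []" using ev'[of "[]" "[]"] by simp
    moreover have "ev' [] \<in> carrier G" using ev'_H[of "[]"] level_subgroup_subset by auto
    ultimately show ?thesis using l_cancel_one by simp
  qed
  have ev'_eq: "ev' u = ev' v \<longleftrightarrow> (u, v) \<in> pres_rel X R" if "u \<in> words X" "v \<in> words X" for u v
    unfolding ev'_def
    using inj_on_eq_iff[OF bij(1) cl[OF that(1)] cl[OF that(2)]] word_class_eq_iff[OF that] by blast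
  have "\<exists>w. w \<in> lists V \<and> level_word w \<and> ev w = ev' [(x, True)]" if "x \<in> X" for x
  proof -
    have "ev' [(x, True)] \<in> level_subgroup" using that by (intro ev'_H) simp
    then show ?thesis by (auto simp: level_subgroup_def)
  qed
  then obtain \<omega> where \<omega>: "\<And>x. x \<in> X \<Longrightarrow> \<omega> x \<in> lists V \<and> level_word (\<omega> x) \<and> ev (\<omega> x) = ev' [(x, True)]"
    by metis
  define letter where "letter = (\<lambda>(x, b). if b then \<omega> x else rev (\<omega> x))"
  define \<Omega> where "\<Omega> w = concat (map letter w)" for w
  have letter: "letter (x, b) \<in> lists V \<and> level_word (letter (x, b)) \<and> ev (letter (x, b)) = ev' [(x, b)]"
    if x: "x \<in> X" for x b
  proof (cases b)
    case True
    then show ?thesis using \<omega>[OF x] by (simp add: letter_def)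
  next
    case False
    have "ev' ([(x, False)] @ [(x, True)]) = ev' []"
      using ev'_eq[of "[(x, False)] @ [(x, True)]" "[]"] x
        pres_rel.cancel[of "[]" X "[]" x False R] by simp
    then have "ev' [(x, False)] \<otimes> ev (\<omega> x) = \<one>"
      using ev'[of "[(x, False)]" "[(x, True)]"] x \<omega>[OF x] ev'_Nil by simp
    moreover have "ev' [(x, False)] \<in> carrier G"
      using ev'_H[of "[(x, False)]"] x level_subgroup_subset
      by auto
    ultimately have "ev (rev (\<omega> x)) = ev' [(x, False)]"
      using inv_equality[of "ev' [(x, False)]" "ev (\<omega> x)"] ev_in_carrier[of "\<omega> x"]
        ev_rev[of "\<omega> x"] \<omega>[OF x] by simp
    then show ?thesis using False \<omega>[OF x] rev_in_lists level_word_rev by (simp add: letter_def)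
  qed
  have \<Omega>: "\<Omega> w \<in> lists V \<and> level_word (\<Omega> w) \<and> ev (\<Omega> w) = ev' w" if "w \<in> words X" for w
    using that
  proof (induction w rule: list.induct)
    case Nil
    then show ?case by (simp add: \<Omega>_def ev'_Nil ev_Nil)
  next
    case (Cons l w)
    obtain x b where l: "l = (x, b)" by force
    have x: "x \<in> X" "w \<in> words X" using Cons.prems l by auto
    have IH: "\<Omega> w \<in> lists V" "level_word (\<Omega> w)" "ev (\<Omega> w) = ev' w" using Cons.IH x by auto
    have "\<Omega> (l # w) = letter (x, b) @ \<Omega> w" by (simp add: \<Omega>_def l)
    moreover have "ev' (l # w) = ev' [(x, b)] \<otimes> ev' w" using ev'[of "[(x, b)]" w] x l by simp
    ultimately show ?case
      using letter[OF x(1), of b] IH ev_append[of "letter (x, b)" "\<Omega> w"]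
        level_word_append[of "letter (x, b)" "\<Omega> w"] by simp
  qed
  have \<Omega>_app: "\<Omega> (u @ v) = \<Omega> u @ \<Omega> v" for u v by (simp add: \<Omega>_def)
  have \<Omega>_ceq: "(u, v) \<in> pres_rel X R \<longleftrightarrow> \<Omega> u \<approx> \<Omega> v" if "u \<in> words X" "v \<in> words X" for u v
    using ev'_eq[OF that] ev_eq_iff[of "\<Omega> u" "\<Omega> v"] \<Omega>[OF that(1)] \<Omega>[OF that(2)] by simp
  \<comment> \<open>Finitely many relators bound the height of the squares needed to contract their loops.\<close>
  have RX: "r \<in> words X" if "r \<in> R" for r using that R(2) by (auto simp: X_def)
  have "\<Omega> r \<approx> []" if "r \<in> R" for r
  proof -
    have "([] @ r @ [], [] @ []) \<in> pres_rel X R" using that RX by (intro pres_rel.relator) auto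
    then have "\<Omega> r \<approx> \<Omega> []" using \<Omega>_ceq[of r "[]"] RX[OF that] by simp
    then show ?thesis by (simp add: \<Omega>_def)
  qed
  then obtain U1 where U1: "\<forall>r\<in>R. hom_below U1 (\<Omega> r) []"
    using uniform_hom_below[OF R(1), of \<Omega> "\<lambda>_. []"] by blast
  have "\<exists>w. w \<in> words X \<and> t \<approx> \<Omega> w" if t: "t \<in> short_gens" for t
  proof -
    have "ev t \<in> level_subgroup" using short_genD[OF t] ev_in_level_subgroup_iff by simp
    then obtain w where "w \<in> words X" "ev t = ev' w"
      using bij(2) by (auto simp: ev'_def carrier_presented_group)
    then show ?thesis using \<Omega>[of w] ev_eq_iff[of t "\<Omega> w"] short_genD[OF t] by auto
  qed
  then obtain \<rho> where \<rho>: "\<And>t. t \<in> short_gens \<Longrightarrow> \<rho> t \<in> words X \<and> t \<approx> \<Omega> (\<rho> t)" by metis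
  then obtain U2 where U2: "\<forall>t\<in>short_gens. hom_below U2 t (\<Omega> (\<rho> t))"
    using uniform_hom_below[OF finite_short_gens, of "\<lambda>t. t" "\<lambda>t. \<Omega> (\<rho> t)"] by blast
  define U where "U = max U1 U2"
  have UR: "hom_below U (\<Omega> r) []" if "r \<in> R" for r
    using U1 that by (auto simp: U_def intro: hom_below_mono)
  have US: "hom_below U t (\<Omega> (\<rho> t))" if "t \<in> short_gens" for t
    using U2 that by (auto simp: U_def intro: hom_below_mono)
  have pres_hom_below: "hom_below U (\<Omega> u) (\<Omega> v)" if "(u, v) \<in> pres_rel X R" for u v
    using that
  proof (induction rule: pres_rel.induct)
    case (cancel u v x b)
    define c where "c = letter (x, b)"
    have "letter (x, \<not> b) = rev c" by (simp add: c_def letter_def)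
    then have "\<Omega> (u @ [(x, b), (x, \<not> b)] @ v) = \<Omega> u @ c @ rev c @ \<Omega> v"
      by (simp add: \<Omega>_def c_def)
    then show ?case using hom_below_cancel_rev by (simp add: \<Omega>_app)
  next
    case (relator u v r)
    have "level_word (\<Omega> u)" using \<Omega> relator by blast
    then have "hom_below U (\<Omega> u @ \<Omega> r) (\<Omega> u @ [])" using UR[OF relator(3)]
      by (rule hom_below_level_word_left)
    then have "hom_below U ((\<Omega> u @ \<Omega> r) @ \<Omega> v) ((\<Omega> u @ []) @ \<Omega> v)" by (rule hom_below_append)
    then show ?case by (simp add: \<Omega>_app)
  qed (blast intro: hom_below_refl hom_below_sym hom_below_trans)+
  have rewrite: "\<exists>w\<in>words X. hom_below U (concat ts) (\<Omega> w)" if "ts \<in> lists short_gens" for ts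
    using that
  proof (induction ts rule: rev_induct)
    case Nil
    then show ?case by (intro bexI[of _ "[]"]) (auto simp: \<Omega>_def)
  next
    case (snoc t ts)
    then obtain w where w: "w \<in> words X" "hom_below U (concat ts) (\<Omega> w)" by auto
    have t: "t \<in> short_gens" using snoc.prems by auto
    have "hom_below U (concat ts @ t) (\<Omega> w @ t)" using w(2) by (rule hom_below_append)
    moreover have "hom_below U (\<Omega> w @ t) (\<Omega> w @ \<Omega> (\<rho> t))"
      using \<Omega>[OF w(1)] US[OF t] hom_below_level_word_left
      by blast
    ultimately have "hom_below U (concat (ts @ [t])) (\<Omega> (w @ \<rho> t))"
      by (auto simp: \<Omega>_app intro: hom_below_trans)
    then show ?case using w(1) \<rho>[OF t] by (intro bexI[of _ "w @ \<rho> t"]) auto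
  qed
  have "hom_below U w []" if w: "w \<in> lists V" "confined 0 1 [] w" "w \<approx> []" for w
  proof -
    have "level_word w" using level_word_ceq[OF w(3)] by simp
    then obtain ts where ts: "ts \<in> lists short_gens" "hom_below U (concat ts) w"
      using level_loop_factor[OF w(1,2)] by blast
    obtain z where z: "z \<in> words X" "hom_below U (concat ts) (\<Omega> z)" using rewrite[OF ts(1)] by blast
    have wz: "hom_below U w (\<Omega> z)" using ts(2) z(2) by (meson hom_below_sym hom_below_trans)
    have "\<Omega> z \<approx> []" by (rule ceq_trans[OF ceq_sym[OF hom_below_imp_ceq[OF wz]] w(3)])
    then have "\<Omega> z \<approx> \<Omega> []" by (simp add: \<Omega>_def)
    then have "(z, []) \<in> pres_rel X R" using \<Omega>_ceq[OF z(1), of "[]"] by simp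
    then have "hom_below U (\<Omega> z) (\<Omega> [])" by (rule pres_hom_below)
    then have "hom_below U (\<Omega> z) []" by (simp add: \<Omega>_def)
    with wz show ?thesis by (rule hom_below_trans)
  qed
  then show ?thesis by blast
qed

lemma not_finitely_presentable_level_subgroup:
  assumes "a \<in> V" "horizontal a" "par a" "b \<in> V" "\<not> horizontal b" "par b" "E a b"
    and "(b, a) \<in> {(r, r'). r \<in> colour_link V horizontal par True True \<and>
      r' \<in> colour_link V horizontal par True True \<and> E r r' \<and> (r, r') \<noteq> (a, b) \<and> (r, r') \<noteq> (b, a)}\<^sup>*"
  shows "\<not> finitely_presentable (G\<lparr>carrier := level_subgroup\<rparr>)"
proof
  assume "finitely_presentable (G\<lparr>carrier := level_subgroup\<rparr>)"
  then obtain U where "\<forall>w\<in>lists V. confined 0 1 [] w \<longrightarrow> w \<approx> [] \<longrightarrow> hom_below U w []"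
    using finitely_presentable_imp_null_homotopies by blast
  moreover interpret half_wall E V horizontal par a b by unfold_locales fact
  have "\<exists>w\<in>lists V. confined 0 1 [] w \<and> w \<approx> [] \<and> \<not> hom_below U w []"
    by (rule essential_strip_loop) fact+
  ultimately show False by blast
qed

end

section \<open>Cycles and links in partite graphs\<close>

lemma three_cycleI:
  assumes "pair_graph D" "(a, b) \<in> parcs D" "(b, c) \<in> parcs D" "(c, a) \<in> parcs D"
  shows "contains_cycle (with_proj D) 3"
proof -
  interpret pair_graph D by fact
  have "a \<noteq> b" "b \<noteq> c" "c \<noteq> a" "a \<in> pverts D" "b \<in> pverts D" "c \<in> pverts D"
    using assms pair_no_loops arc_fst_in_verts arc_snd_in_verts by fastforce+
  then have "pre_digraph.cycle (with_proj D) [(a, b), (b, c), (c, a)]"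
    using assms unfolding pre_digraph.cycle_def
    by (intro exI[of _ a]) (auto simp: pre_digraph.awalk_def pre_digraph.cas.simps
        pre_digraph.awalk_verts.simps)
  then show ?thesis unfolding contains_cycle_def
    by (intro conjI exI[of _ "[(a, b), (b, c), (c, a)]"]) auto
qed

lemma four_cycleI:
  assumes "pair_graph D" "(a, b) \<in> parcs D" "(b, c) \<in> parcs D" "(c, d) \<in> parcs D" "(d, a) \<in> parcs D"
    and "a \<noteq> c" "b \<noteq> d"
  shows "contains_cycle (with_proj D) 4"
proof -
  interpret pair_graph D by fact
  have "a \<noteq> b" "b \<noteq> c" "c \<noteq> d" "d \<noteq> a" "a \<in> pverts D" "b \<in> pverts D" "c \<in> pverts D" "d \<in> pverts D"
    using assms pair_no_loops arc_fst_in_verts arc_snd_in_verts by fastforce+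
  then have "pre_digraph.cycle (with_proj D) [(a, b), (b, c), (c, d), (d, a)]"
    using assms unfolding pre_digraph.cycle_def
    by (intro exI[of _ a]) (auto simp: pre_digraph.awalk_def pre_digraph.cas.simps
        pre_digraph.awalk_verts.simps)
  then show ?thesis unfolding contains_cycle_def
    by (intro conjI exI[of _ "[(a, b), (b, c), (c, d), (d, a)]"]) auto
qed

lemma four_cycle_graphE:
  assumes "cycle_graph (with_proj D) 4"
  obtains a b c d where "distinct [a, b, c, d]" "pverts D = {a, b, c, d}"
    "parcs D = {(a, b), (b, c), (c, d), (d, a), (b, a), (c, b), (d, c), (a, d)}"
proof -
  obtain p where p: "pre_digraph.cycle (with_proj D) p" "length p = 4"
    "pverts D = snd ` set p" "parcs D = set p \<union> (set p)\<inverse>"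
    using assms unfolding cycle_graph_def by (auto simp: arc_to_ends_def)
  obtain e1 e2 e3 e4 where "p = [e1, e2, e3, e4]"
    using p(2) by (auto simp: numeral_eq_Suc length_Suc_conv)
  moreover obtain a a' b b' c c' d d' where "e1 = (a, a')" "e2 = (b, b')" "e3 = (c, c')" "e4 = (d, d')"
    by force
  moreover have "a' = b" "b' = c" "c' = d" "d' = a" "distinct [a, b, c, d]"
    using p(1) unfolding calculation
    by (auto simp: pre_digraph.cycle_def pre_digraph.awalk_def pre_digraph.cas.simps
        pre_digraph.awalk_verts.simps)
  ultimately show ?thesis using that[of a b c d] p(3,4) by auto
qed

lemma connected_induced:
  assumes "pair_graph D" "connected (with_proj D \<restriction> S)" "s \<in> S" "r \<in> S"
  shows "(s, r) \<in> {(a, b). a \<in> S \<and> b \<in> S \<and> (a, b) \<in> parcs D}\<^sup>*"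
proof -
  interpret pair_graph D by fact
  have sym: "(y, x) \<in> parcs D" if "(x, y) \<in> parcs D" for x y
    using that pair_sym_arcs by (auto simp: symmetric_def dest: symD)
  have "(s, r) \<in> rtrancl_on S (parcs (mk_symmetric (with_proj D \<restriction> S)))"
    using assms(2-4) by (auto simp: connected_def strongly_connected_def reachable_def)
  then show ?thesis
  proof (induction rule: rtrancl_on_induct)
    case (step y z)
    then have "y \<in> S \<and> z \<in> S \<and> (y, z) \<in> parcs D"
      using sym by (auto simp: parcs_mk_symmetric)
    then show ?case using step(5) by (auto intro: rtrancl_into_rtrancl)
  qed simp
qed

lemma cas_imp_rtrancl:
  "pre_digraph.cas (with_proj D \<restriction> S) u p v \<Longrightarrow> set p \<subseteq> r \<Longrightarrow> (u, v) \<in> r\<^sup>*"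
proof (induction p arbitrary: u)
  case (Cons e p)
  then have "(u, snd e) \<in> r" "(snd e, v) \<in> r\<^sup>*"
    by (auto simp: pre_digraph.cas.simps)
  then show ?case by (rule converse_rtrancl_into_rtrancl)
qed (simp add: pre_digraph.cas.simps)

lemma awalk_verts_tl:
  "pre_digraph.cas (with_proj D \<restriction> S) u p v \<Longrightarrow>
    tl (pre_digraph.awalk_verts (with_proj D \<restriction> S) u p) = map snd p"
proof (induction p arbitrary: u)
  case (Cons e p)
  then have c: "pre_digraph.cas (with_proj D \<restriction> S) (snd e) p v" by (simp add: pre_digraph.cas.simps)
  have "pre_digraph.awalk_verts (with_proj D \<restriction> S) (snd e) p = snd e # map snd p"
    using Cons.IH[OF c] c by (cases p) (auto simp: pre_digraph.awalk_verts.simps pre_digraph.cas.simps)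
  then show ?case by (simp add: pre_digraph.awalk_verts.simps)
qed (simp add: pre_digraph.awalk_verts.simps)

text \<open>Any arc of the cycle will do: the rest of the cycle leads back. Its arcs differ from the chosen
  arc \<open>e\<close> and from the reverse of \<open>e\<close> because the heads of the arcs are distinct and there are at
  least three of them.\<close>
lemma cycle_graph_edge_bypass:
  assumes "cycle_graph (with_proj D \<restriction> S) n"
  obtains a b where "(a, b) \<in> parcs D" "a \<in> S" "b \<in> S"
    "(b, a) \<in> {(x, y). x \<in> S \<and> y \<in> S \<and> (x, y) \<in> parcs D \<and> (x, y) \<noteq> (a, b) \<and> (x, y) \<noteq> (b, a)}\<^sup>*"
proof -
  let ?C = "with_proj D \<restriction> S"
  obtain p u where p: "n \<ge> 3" "length p = n" "pre_digraph.awalk ?C u p u"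
    "distinct (tl (pre_digraph.awalk_verts ?C u p))"
    using assms unfolding cycle_graph_def pre_digraph.cycle_def by blast
  have cas: "pre_digraph.cas ?C u p u" and arcs: "set p \<subseteq> arcs ?C"
    using p(3) by (auto simp: pre_digraph.awalk_def)
  have dist: "distinct (map snd p)" using p(4) awalk_verts_tl[OF cas] by simp
  obtain e p' where e: "p = e # p'" using p(1,2) by (cases p) auto
  have cas': "pre_digraph.cas ?C (snd e) p' (fst e)" and u: "u = fst e"
    using cas by (auto simp: e pre_digraph.cas.simps)
  have last: "snd (last q) = w" if "pre_digraph.cas ?C v q w" "q \<noteq> []" for v q w
    using that
  proof (induction q arbitrary: v)
    case (Cons f q)
    then show ?case by (cases q) (auto simp: pre_digraph.cas.simps)
  qed simp
  obtain q f where q: "p' = q @ [f]" using p(1,2) e by (cases p' rule: rev_cases) auto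
  have "q \<noteq> []" using p(1,2) e q by auto
  have cas_q: "pre_digraph.cas ?C v (q @ [f]) w \<Longrightarrow> pre_digraph.cas ?C v q (fst f)" for v w q
    by (induction q arbitrary: v) (auto simp: pre_digraph.cas.simps)
  have f: "snd f = fst e" using last[OF cas'] q by simp
  have ff: "fst f = snd (last q)"
    using last[OF cas_q[of "snd e" q "fst e"]] cas' q \<open>q \<noteq> []\<close> by simp
  have "g \<noteq> e" if "g \<in> set p'" for g using that dist e by auto
  moreover have "g \<noteq> (snd e, fst e)" if g: "g \<in> set p'" for g
  proof
    assume ge: "g = (snd e, fst e)"
    show False
    proof (cases "g \<in> set q")
      case True
      then have "snd f \<in> snd ` set q" using f ge by force
      then show False using dist e q by auto
    next
      case False
      then have "snd e = snd (last q)" using g q ge ff by auto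
      then have "snd e \<in> snd ` set p'" using last_in_set[OF \<open>q \<noteq> []\<close>] q by auto
      then show False using dist e by auto
    qed
  qed
  ultimately have "set p' \<subseteq> {(x, y). x \<in> S \<and> y \<in> S \<and> (x, y) \<in> parcs D \<and>
      (x, y) \<noteq> (fst e, snd e) \<and> (x, y) \<noteq> (snd e, fst e)}"
    using arcs e by fastforce
  then have "(snd e, fst e) \<in> {(x, y). x \<in> S \<and> y \<in> S \<and> (x, y) \<in> parcs D \<and>
      (x, y) \<noteq> (fst e, snd e) \<and> (x, y) \<noteq> (snd e, fst e)}\<^sup>*"
    using cas' by (rule cas_imp_rtrancl[rotated])
  moreover have "(fst e, snd e) \<in> parcs D" "fst e \<in> S" "snd e \<in> S" using arcs e by auto
  ultimately show ?thesis using that by blast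
qed

section \<open>A finitely generated subgroup that is not finitely presentable\<close>

theorem theorem6p3:
  fixes \<Gamma> :: "'b pair_pre_digraph"
    and \<Delta> :: "'a pair_pre_digraph"
    and A :: "'b \<Rightarrow> 'a set"
  assumes "pair_graph \<Gamma>" and "cycle_graph (with_proj \<Gamma>) 4"
    and "pair_graph \<Delta>"
    and "partite \<Gamma> \<Delta> A" and "cycle_connectors \<Gamma> \<Delta> A"
    and "\<not> contains_cycle (with_proj \<Delta>) 3"
    and "\<not> contains_cycle (with_proj \<Delta>) 4"
  shows "racg_two_dimensional \<Delta> \<and>
    hyperbolic_group (racg \<Delta>) \<and>
    (\<exists>H. subgroup H (racg \<Delta>) \<and>
      finitely_generated ((racg \<Delta>)\<lparr>carrier := H\<rparr>) \<and>
      \<not> finitely_presentable ((racg \<Delta>)\<lparr>carrier := H\<rparr>) \<and>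
      \<not> quasiconvex (racg \<Delta>) (racg_gens \<Delta>) H)"
proof -
  obtain s1 s2 s3 s4 where dist: "distinct [s1, s2, s3, s4]" and V\<Gamma>: "pverts \<Gamma> = {s1, s2, s3, s4}"
    and E\<Gamma>: "parcs \<Gamma> = {(s1, s2), (s2, s3), (s3, s4), (s4, s1), (s2, s1), (s3, s2), (s4, s3), (s1, s4)}"
    using four_cycle_graphE[OF assms(2)] by blast
  interpret \<Delta>: pair_graph \<Delta> by fact
  define E where "E = (\<lambda>s t. (s, t) \<in> parcs \<Delta>)"
  define V where "V = pverts \<Delta>"
  (* With this choice, the four pairs of parts that can be links of vertices are the four edges of
     the 4-cycle s1 s2 s3 s4. *)
  define horizontal where "horizontal v \<longleftrightarrow> v \<in> A s1 \<union> A s3" for v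
  define par where "par v \<longleftrightarrow> v \<in> A s3 \<union> A s4" for v
  have V: "V = A s1 \<union> A s2 \<union> A s3 \<union> A s4"
    and ne: "A s1 \<noteq> {}" "A s2 \<noteq> {}" "A s3 \<noteq> {}" "A s4 \<noteq> {}"
    and disj: "A s1 \<inter> A s2 = {}" "A s1 \<inter> A s3 = {}" "A s1 \<inter> A s4 = {}" "A s2 \<inter> A s3 = {}"
      "A s2 \<inter> A s4 = {}" "A s3 \<inter> A s4 = {}"
    using assms(4) dist unfolding partite_def V\<Gamma> V_def by auto
  have inner: "\<not> E a b" if "a \<in> A s" "b \<in> A s" "s \<in> pverts \<Gamma>" for a b s
    using assms(4) that unfolding partite_def E_def by blast
  have conn: "connected (with_proj \<Delta> \<restriction> (A s \<union> A t))" if "(s, t) \<in> parcs \<Gamma>" for s t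
  proof -
    have "s \<in> pverts \<Gamma>" "t \<in> pverts \<Gamma>" "s \<noteq> t" using that dist unfolding V\<Gamma> E\<Gamma> by auto
    then show ?thesis using assms(4) that unfolding partite_def by meson
  qed
  have no_arcs: "\<not> E a b" if "a \<in> A s \<union> A t" "b \<in> A s \<union> A t"
    "s \<in> pverts \<Gamma>" "t \<in> pverts \<Gamma>" "s \<noteq> t" "(s, t) \<notin> parcs \<Gamma>" for a b s t
  proof -
    have "arcs (with_proj \<Delta> \<restriction> (A s \<union> A t)) = {}"
      using assms(4) that(3-6) unfolding partite_def by meson
    then show ?thesis using that(1,2) by (auto simp: E_def)
  qed
  have E_V: "a \<in> V \<and> b \<in> V" if "E a b" for a b
    using that \<Delta>.arc_fst_in_verts \<Delta>.arc_snd_in_verts unfolding E_def V_def by fastforce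
  have E_horizontal: "horizontal a \<noteq> horizontal b" if "E a b" for a b
  proof
    assume "horizontal a = horizontal b"
    then have "a \<in> A s1 \<union> A s3 \<and> b \<in> A s1 \<union> A s3 \<or> a \<in> A s2 \<union> A s4 \<and> b \<in> A s2 \<union> A s4"
      using E_V[OF that] unfolding V horizontal_def by blast
    then show False
      using that no_arcs[of a s1 s3 b] no_arcs[of a s2 s4 b] dist unfolding V\<Gamma> E\<Gamma> by auto
  qed
  have link: "colour_link V horizontal par p q = A (if p then s3 else s1) \<union> A (if q then s4 else s2)" for p q
    using disj unfolding colour_link_def V horizontal_def par_def by (cases p; cases q) auto
  interpret W: word_group E "racg \<Delta>" V
    "\<lambda>w. word_class (pverts \<Delta>) (racg_relators \<Delta>) (map (\<lambda>s. (s, True)) w)"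
    unfolding E_def V_def by (rule word_group_racg[OF assms(3)])
  have "morse_graph_axioms E V horizontal par"
  proof
    show "finite V" unfolding V_def by (rule \<Delta>.pair_finite_verts)
    show "horizontal s \<noteq> horizontal t" if "E s t" for s t using that by (rule E_horizontal)
    show "\<exists>a\<in>V. horizontal a = d \<and> par a = p" for d p
    proof -
      obtain x1 x2 x3 x4 where x: "x1 \<in> A s1" "x2 \<in> A s2" "x3 \<in> A s3" "x4 \<in> A s4"
        using ne by blast
      then have "horizontal x1 \<and> \<not> par x1" "\<not> horizontal x2 \<and> \<not> par x2" "horizontal x3 \<and> par x3" "\<not> horizontal x4 \<and> par x4"
        using disj unfolding horizontal_def par_def by blast+
      moreover have "x1 \<in> V" "x2 \<in> V" "x3 \<in> V" "x4 \<in> V" using x unfolding V by blast+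
      ultimately show ?thesis by (cases d; cases p) blast+
    qed
    show "(s, r) \<in> {(a, b). a \<in> colour_link V horizontal par p q \<and> b \<in> colour_link V horizontal par p q \<and> E a b}\<^sup>*"
      if "s \<in> colour_link V horizontal par p q" "r \<in> colour_link V horizontal par p q" for s p q r
      using that unfolding link E_def
      by (intro connected_induced[OF assms(3)] conn) (auto simp: E\<Gamma>)
  qed
  then interpret F: fibred_word_group E "racg \<Delta>" V
    "\<lambda>w. word_class (pverts \<Delta>) (racg_relators \<Delta>) (map (\<lambda>s. (s, True)) w)" horizontal par
    by (intro fibred_word_group.intro W.word_group_axioms morse_graph.intro W.commutation_graph_axioms)
  have gens: "racg_gens \<Delta> = W.gens" by (simp add: racg_gens_def V_def)
  have "girth_five_graph E"
  proof
    show False if "E a b" "E b c" "E c a" for a b c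
      using that assms(6) three_cycleI[OF assms(3)] unfolding E_def by blast
    show False if "E a b" "E b c" "E c d" "E d a" "a \<noteq> c" "b \<noteq> d" for a b c d
      using that assms(7) four_cycleI[OF assms(3)] unfolding E_def by blast
  qed
  then have hyp: "hyperbolic_group (racg \<Delta>)" by (rule W.hyperbolic_if_girth_five)
  define S where "S = A s3 \<union> A s4"
  have S: "colour_link V horizontal par True True = S" unfolding link S_def by simp
  obtain n where n: "cycle_graph (with_proj \<Delta> \<restriction> S) n"
  proof -
    obtain x y where xy: "x \<in> A s3" "y \<in> A s4" using ne by blast
    then have "x \<noteq> y" using disj by blast
    moreover have "(x, y) \<in> {(a, b). a \<in> S \<and> b \<in> S \<and> (a, b) \<in> parcs \<Delta>}\<^sup>*"
      using connected_induced[OF assms(3) conn[of s3 s4]] xy unfolding S_def E\<Gamma> by auto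
    ultimately obtain z where "(x, z) \<in> {(a, b). a \<in> S \<and> b \<in> S \<and> (a, b) \<in> parcs \<Delta>}"
      by (meson converse_rtranclE)
    then have "(x, z) \<in> arcs (with_proj \<Delta> \<restriction> S)" by auto
    moreover have "s3 \<in> pverts \<Gamma>" "s4 \<in> pverts \<Gamma>" "s3 \<noteq> s4" using dist unfolding V\<Gamma> by auto
    ultimately show ?thesis using that assms(5) unfolding cycle_connectors_def S_def by blast
  qed
  obtain a b where ab: "(a, b) \<in> parcs \<Delta>" "a \<in> S" "b \<in> S"
    "(b, a) \<in> {(x, y). x \<in> S \<and> y \<in> S \<and> (x, y) \<in> parcs \<Delta> \<and> (x, y) \<noteq> (a, b) \<and> (x, y) \<noteq> (b, a)}\<^sup>*"
    using cycle_graph_edge_bypass[OF n] by blast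
  (* The horizontal end of the edge may be a or b. *)
  have bypass_sym: "(a, b) \<in> {(x, y). x \<in> S \<and> y \<in> S \<and> (x, y) \<in> parcs \<Delta> \<and> (x, y) \<noteq> (b, a) \<and> (x, y) \<noteq> (a, b)}\<^sup>*"
  proof -
    have "sym {(x, y). x \<in> S \<and> y \<in> S \<and> (x, y) \<in> parcs \<Delta> \<and> (x, y) \<noteq> (b, a) \<and> (x, y) \<noteq> (a, b)}"
      using W.E_sym unfolding sym_def E_def by blast
    moreover have "(b, a) \<in> {(x, y). x \<in> S \<and> y \<in> S \<and> (x, y) \<in> parcs \<Delta> \<and> (x, y) \<noteq> (b, a) \<and> (x, y) \<noteq> (a, b)}\<^sup>*"
      using ab(4) by (simp only: conj_commute)
    ultimately show ?thesis using sym_rtrancl by (blast dest: symD)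
  qed
  have nfp: "\<not> finitely_presentable ((racg \<Delta>)\<lparr>carrier := F.level_subgroup\<rparr>)"
  proof (cases "horizontal a")
    case True
    have "a \<in> V" "par a" "b \<in> V" "par b" "E a b"
      using ab unfolding S_def V par_def E_def by auto
    moreover have "\<not> horizontal b" using E_horizontal[OF \<open>E a b\<close>] True by simp
    ultimately show ?thesis
      using F.not_finitely_presentable_level_subgroup[of a b] True ab(4) unfolding S E_def by blast
  next
    case False
    have "b \<in> V" "par b" "a \<in> V" "par a" "E b a"
      using ab W.E_sym unfolding S_def V par_def E_def by auto
    moreover have "horizontal b" using E_horizontal[OF \<open>E b a\<close>] False by simp
    ultimately show ?thesis
      using F.not_finitely_presentable_level_subgroup[of b a] False bypass_sym unfolding S E_def
        by blast
  qed
  have "racg_two_dimensional \<Delta>" unfolding racg_two_dimensional_def by fact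
  moreover have "\<not> quasiconvex (racg \<Delta>) (racg_gens \<Delta>) F.level_subgroup"
    unfolding gens by (rule F.not_quasiconvex_level_subgroup)
  ultimately show ?thesis
    using hyp nfp F.subgroup_level_subgroup F.finitely_generated_level_subgroup by blast
qed

end
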